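(* Let $A,B,D_1,D_2,D_3,C_1,C_2,\widetilde C_3(\cdot),r$, the supply-rate matrices $\widetilde J,J_1,J_2,J_3$, and $\boldsymbol f(\cdot),M,\mathfrak F,F(\cdot),C_3,\Gamma,K,X$ be given as described in the context (including the decomposition assumption stated there). Suppose that there exist matrices $P\in\mathbb S^{\nu}$, $Q\in\mathbb R^{\nu\times d\nu}$, $R\in\mathbb S^{d\nu}$, $S,U\in\mathbb S^{\nu}$, $K_1,K_2\in\mathbb R^{p\times\nu}$ and $K_3\in\mathbb R^{p\times d\nu}$ such that $$\begin{bmatrix} P & Q\\ Q^\top & R+I_d\otimes S\end{bmatrix}\succ 0,\qquad S\succ 0,\qquad U\succ 0,$$ $$\boldsymbol\Phi+\mathsf{Sy}\left(\mathbf P^\top\begin{bmatrix}\boldsymbol\Pi & \mathsf O_{\nu,m}\end{bmatrix}\right)\prec 0,$$ where $\boldsymbol\Pi=\mathbf A+\mathbf B\mathbf K$, $\mathbf P=\begin{bmatrix}P & \mathsf O_{\nu} & Q & \mathsf O_{\nu,(q+m)}\end{bmatrix}$, $$\mathbf A=\begin{bmatrix}A & \mathsf O_{n,\nu} & B & \mathsf O_{n,d\nu} & D_1\\ \mathsf O_{p,n} & \mathsf O_{p,\nu} & \mathsf O_{p} & \mathsf O_{p,d\nu} & D_2\end{bmatrix},\quad \mathbf B=\begin{bmatrix}\mathsf O_{n,p}\\ I_p\end{bmatrix},\quad \mathbf K=\begin{bmatrix}K_1 & K_2 & K_3 & \mathsf O_{p,q}\end{bmatrix},$$ $$\boldsymbol\Phi=\mathsf{Sy}\left(\begin{bmatrix}Q\\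 \mathsf O_{\nu,d\nu}\\ R\\ \mathsf O_{(q+m),d\nu}\end{bmatrix}\begin{bmatrix}\mathbf F & \mathsf O_{d\nu,m}\end{bmatrix}\right)+(S+rU)\oplus(-S)\oplus(-I_d\otimes U)\oplus(-J_3)\oplus J_1+\mathsf{Sy}\left(\begin{bmatrix}\mathsf O_{m,(2\nu+d\nu)} & -J_2 & \widetilde J^{\top}\end{bmatrix}^\top\begin{bmatrix}\boldsymbol\Sigma & \mathsf O_{m}\end{bmatrix}\right),$$ $$\mathbf F=\begin{bmatrix}F(0) & -F(-r) & -\left(\sqrt{\mathfrak F^{-1}}\,M\sqrt{\mathfrak F}\right)\otimes I_\nu & \mathsf O_{d\nu,q}\end{bmatrix},\qquad \boldsymbol\Sigma=\begin{bmatrix}C_1 & C_2 & C_3 & D_3\end{bmatrix}.$$ Then the closed-loop system (CLS) defined in the context with these gains $K_1,K_2,K_3$ is dissipative with respect to the supply rate function $\mathsf s$ defined in the context, and the trivial solution of the CLS with $\boldsymbol w(t)\equiv\mathbf 0_q$ is exponentially stable. Moreover, the total number of scalar unknowns in $P,Q,R,S,U,K_1,K_2,K_3$ is $$(0.5d^2+d+1.5)\nu^2+(0.5d+pd+2p+1.5)\nu\in\mathcal O(d^2\nu^2).$$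
   Context: **Notation.** $\mathbb S^k$ is the set of real symmetric $k\times k$ matrices; $\mathsf{Sy}(Y)=Y+Y^\top$; $\mathsf O_{k,l}$ is the $k\times l$ zero matrix, $\mathsf O_k=\mathsf O_{k,k}$; $\mathbf 0_k$ is the zero column vector; $\otimes$ is the Kronecker product; $X\oplus Y$ is the block-diagonal matrix with diagonal blocks $X,Y$ (iterated for more blocks); $\succ,\prec,\preceq$ refer to definiteness of symmetric matrices; $\sqrt{\cdot}$ of a positive definite matrix is its symmetric positive definite square root. $\|\cdot\|$ is the Euclidean norm. $\mathcal C([-r,0];\mathbb R^\nu)$ is the Banach space of continuous functions with norm $\|\boldsymbol\phi(\cdot)\|_\infty=\sup_{-r\le\tau\le0}\|\boldsymbol\phi(\tau)\|$. **Data.** $m,n,p,q,d\in\mathbb N$, $\nu:=n+p$, $r>0$, $t_0\in\mathbb R$; $A\in\mathbb R^{n\times n}$, $B\in\mathbb R^{n\times p}$, $D_1\in\mathbb R^{n\times q}$, $D_2\in\mathbb R^{p\times q}$, $D_3\in\mathbb R^{m\times q}$, $C_1,C_2\in\mathbb R^{m\times\nu}$, $\widetilde C_3:[-r,0]\to\mathbb R^{m\times\nu}$. It is assumed that some $K\in\mathbb R^{p\times n}$ makes $A+BK$ Hurwitz. **Decomposition assumption.** $\boldsymbol f(\cdot)\in C^1([-r,0];\mathbb R^d)$ satisfies $\frac{\mathsf d\boldsymbol f(\tau)}{\mathsf d\tau}=M\boldsymbol f(\tau)$ for some $M\in\mathbb R^{d\times d}$, and $\mathfrak F=\int_{-r}^0\boldsymbol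 f(\tau)\boldsymbol f^\top(\tau)\,\mathsf d\tau\succ0$. Put $$F(\tau)=\left(\sqrt{\mathfrak F^{-1}}\,\boldsymbol f(\tau)\right)\otimes I_\nu\in\mathbb R^{d\nu\times\nu}.$$ There are matrices $C_3\in\mathbb R^{m\times d\nu}$ and $\Gamma\in\mathbb R^{p\times d\nu}$ with $\widetilde C_3(\tau)=C_3F(\tau)$ and $\begin{bmatrix}\mathsf O_{p,n} & (KA-XK)e^{-A\tau}B\end{bmatrix}=\Gamma F(\tau)$ on $[-r,0]$, where $X\in\mathbb R^{p\times p}$ is any Hurwitz matrix and $K\in\mathbb R^{p\times n}$ is any matrix such that $A+BK$ is Hurwitz. **Closed-loop system (CLS).** The open-loop system is $\dot{\boldsymbol x}(t)=A\boldsymbol x(t)+B\boldsymbol u(t-r)+D_1\boldsymbol w(t)$ with $\boldsymbol x(t)\in\mathbb R^n$, $\boldsymbol u(t)\in\mathbb R^p$. Coupling it with the dynamical state feedback $\dot{\boldsymbol u}(t)=K_1\boldsymbol\chi(t)+K_2\boldsymbol\chi(t-r)+\int_{-r}^0K_3F(\tau)\boldsymbol\chi(t+\tau)\,\mathsf d\tau+D_2\boldsymbol w(t)$, where $\boldsymbol\chi(t)=\begin{bmatrix}\boldsymbol x^\top(t) & \boldsymbol u^\top(t)\end{bmatrix}^\top\in\mathbb R^\nu$, gives the CLS: for almost all $t\ge t_0$ (with respect to Lebesgue measure), $$\dot{\boldsymbol\chi}(t)=\begin{bmatrix}\begin{matrix}A & \mathsf O_{n,p}\end{matrix}\\ K_1\end{bmatrix}\boldsymbol\chi(t)+\begin{bmatrix}\begin{matrix}\mathsf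 O_n & B\end{matrix}\\ K_2\end{bmatrix}\boldsymbol\chi(t-r)+\int_{-r}^0\begin{bmatrix}\mathsf O_{n,d\nu}\\ K_3\end{bmatrix}F(\tau)\boldsymbol\chi(t+\tau)\,\mathsf d\tau+\begin{bmatrix}D_1\\ D_2\end{bmatrix}\boldsymbol w(t),$$ $$\boldsymbol z(t)=C_1\boldsymbol\chi(t)+C_2\boldsymbol\chi(t-r)+\int_{-r}^0C_3F(\tau)\boldsymbol\chi(t+\tau)\,\mathsf d\tau+D_3\boldsymbol w(t)\in\mathbb R^m,$$ with $\boldsymbol\chi(t_0+\theta)=\boldsymbol\phi(\theta)$ for all $\theta\in[-r,0]$, initial condition $\boldsymbol\phi(\cdot)\in\mathcal C([-r,0];\mathbb R^\nu)$ and disturbance $\boldsymbol w(\cdot)\in\mathcal L^2([t_0,+\infty);\mathbb R^q)$. Solutions are in the Carathéodory (extended) sense. Write $\boldsymbol\chi_t(\theta)=\boldsymbol\chi(t+\theta)$, $\theta\in[-r,0]$. **Supply rate function.** $$\mathsf s(\boldsymbol z(t),\boldsymbol w(t))=\begin{bmatrix}\boldsymbol z(t)\\ \boldsymbol w(t)\end{bmatrix}^\top\begin{bmatrix}\widetilde J^\top J_1^{-1}\widetilde J & J_2\\ J_2^\top & J_3\end{bmatrix}\begin{bmatrix}\boldsymbol z(t)\\ \boldsymbol w(t)\end{bmatrix},$$ with $\widetilde J\in\mathbb R^{m\times m}$, $J_1\in\mathbb S^m$ invertible with $J_1^{-1}\prec0$ (so $\widetilde J^\top J_1^{-1}\widetilde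 J\preceq0$), $J_2\in\mathbb R^{m\times q}$, $J_3\in\mathbb S^q$. **Dissipativity.** The CLS with supply rate function $\mathsf s$ is dissipative if there is a continuous functional $\mathsf v:\mathcal C([-r,0];\mathbb R^\nu)\to\mathbb R$ such that, for $\boldsymbol\chi$, $\boldsymbol z$, $\boldsymbol w$ satisfying the CLS, $\frac{\mathsf d}{\mathsf dt}\mathsf v(\boldsymbol\chi_t(\cdot))-\mathsf s(\boldsymbol z(t),\boldsymbol w(t))\le0$ for almost all $t\ge t_0$. **Exponential stability** of the trivial solution (with $\boldsymbol w\equiv\mathbf 0_q$) has its standard meaning: there are $\alpha,\beta>0$ with $\|\boldsymbol\chi(t)\|\le\beta e^{-\alpha(t-t_0)}\|\boldsymbol\phi(\cdot)\|_\infty$ for all $t\ge t_0$ and all initial conditions $\boldsymbol\phi$. *)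

theory Defs
  imports "HOL-Analysis.Analysis" "HOL-Library.Landau_Symbols"
begin

text \<open>
  Block matrices are indexed by sum types and Kronecker products by product types, so an
  \<open>(n + p)\<close>-dimensional state has type \<open>real^('n + 'p)\<close> and
  \<open>I\<^sub>d \<otimes> S\<close> has index type \<open>'d \<times> 'k\<close> (lexicographic order).
  All dimensions are therefore positive.
\<close>

definition hcat :: "'a^'k^'m \<Rightarrow> 'a^'l^'m \<Rightarrow> 'a^('k + 'l)^'m"  (infixr \<open>|||\<close> 62) where
  "X ||| Y = (\<chi> i j. case j of Inl a \<Rightarrow> X $ i $ a | Inr b \<Rightarrow> Y $ i $ b)"

definition vcat :: "'a^'k^'m \<Rightarrow> 'a^'k^'l \<Rightarrow> 'a^'k^('m + 'l)"  (infixr \<open>'/'/'/\<close> 61) where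
  "X /// Y = (\<chi> i. case i of Inl a \<Rightarrow> X $ a | Inr b \<Rightarrow> Y $ b)"

definition vec_join :: "'a^'m \<Rightarrow> 'a^'l \<Rightarrow> 'a^('m + 'l)" where
  "vec_join x y = (\<chi> i. case i of Inl a \<Rightarrow> x $ a | Inr b \<Rightarrow> y $ b)"

definition dsum :: "real^'k^'k \<Rightarrow> real^'l^'l \<Rightarrow> real^('k + 'l)^('k + 'l)"  (infixr \<open>\<oplus>\<close> 63) where
  "X \<oplus> Y = (X ||| 0) /// (0 ||| Y)"

definition kron :: "real^'b^'a \<Rightarrow> real^'l^'k \<Rightarrow> real^('b \<times> 'l)^('a \<times> 'k)"  (infixr \<open>\<otimes>\<close> 72) where
  "X \<otimes> Y = (\<chi> ik jl. X $ fst ik $ fst jl * Y $ snd ik $ snd jl)"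

text \<open>Kronecker product of a column vector with a matrix; the columns keep index type \<open>'l\<close>
  instead of \<open>1 \<times> 'l\<close>.\<close>

definition vkron :: "real^'a \<Rightarrow> real^'l^'k \<Rightarrow> real^'l^('a \<times> 'k)" where
  "vkron v Y = (\<chi> ik l. v $ fst ik * Y $ snd ik $ l)"

definition Sy :: "real^'k^'k \<Rightarrow> real^'k^'k" where
  "Sy Y = Y + transpose Y"

definition sym_mat :: "real^'k^'k \<Rightarrow> bool" where
  "sym_mat X \<longleftrightarrow> transpose X = X"

definition pos_def :: "real^'k^'k \<Rightarrow> bool" where
  "pos_def X \<longleftrightarrow> sym_mat X \<and> (\<forall>v. v \<noteq> 0 \<longrightarrow> v \<bullet> (X *v v) > 0)"

definition neg_def :: "real^'k^'k \<Rightarrow> bool" where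
  "neg_def X \<longleftrightarrow> sym_mat X \<and> (\<forall>v. v \<noteq> 0 \<longrightarrow> v \<bullet> (X *v v) < 0)"

definition mat_sqrt :: "real^'k^'k \<Rightarrow> real^'k^'k" where
  "mat_sqrt X = (THE Y. pos_def Y \<and> Y ** Y = X)"

text \<open>The multiplication and power of the type \<open>real^'k^'k\<close> are componentwise, hence the
  library's \<open>exp\<close> cannot be used for matrices.\<close>

definition mat_exp :: "real^'k^'k \<Rightarrow> real^'k^'k" where
  "mat_exp X = (\<Sum>i. (1 / fact i) *\<^sub>R (((**) X ^^ i) (mat 1)))"

definition hurwitz :: "real^'k^'k \<Rightarrow> bool" where
  "hurwitz X \<longleftrightarrow> (\<forall>(c::complex) v. v \<noteq> 0 \<and> map_matrix complex_of_real X *v v = c *s v \<longrightarrow> Re c < 0)"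

definition gram :: "real \<Rightarrow> (real \<Rightarrow> real^'d) \<Rightarrow> real^'d^'d" where
  "gram r f = integral {-r..0} (\<lambda>\<tau>. (columnvector (f \<tau>) :: real^1^'d) ** rowvector (f \<tau>))"

definition Fker :: "real \<Rightarrow> (real \<Rightarrow> real^'d) \<Rightarrow> real \<Rightarrow> real^'k^('d \<times> 'k)" where
  "Fker r f \<tau> = vkron (mat_sqrt (matrix_inv (gram r f)) *v f \<tau>) (mat 1)"

definition abs_cont_on :: "real \<Rightarrow> real \<Rightarrow> (real \<Rightarrow> 'a::real_normed_vector) \<Rightarrow> bool" where
  "abs_cont_on a b g \<longleftrightarrow>
    (\<forall>e>0. \<exists>\<delta>>0. \<forall>I :: (real \<times> real) set.
       finite I \<and> (\<forall>(u, v)\<in>I. a \<le> u \<and> u \<le> v \<and> v \<le> b) \<and>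
       pairwise (\<lambda>(u, v) (u', v'). {u<..<v} \<inter> {u'<..<v'} = {}) I \<and>
       (\<Sum>(u, v)\<in>I. v - u) < \<delta> \<longrightarrow> (\<Sum>(u, v)\<in>I. norm (g v - g u)) < e)"

text \<open>\<open>cls \<dots> \<phi> w x z\<close>: with initial function \<open>\<phi>\<close> and disturbance \<open>w\<close>, \<open>x\<close> is a Caratheodory
  solution of the closed-loop system and \<open>z\<close> the corresponding output. Only the values of \<open>x\<close> on
  \<open>[t0 - r, \<infinity>)\<close>, of \<open>z\<close>, \<open>w\<close> on \<open>[t0, \<infinity>)\<close> and of \<open>F\<close>, \<open>\<phi>\<close> on \<open>[-r, 0]\<close> matter.\<close>

definition cls ::
  "real \<Rightarrow> real \<Rightarrow> real^'n^'n \<Rightarrow> real^'p^'n \<Rightarrow> real^'q^'n \<Rightarrow> real^'q^'p \<Rightarrow> real^'q^'m \<Rightarrow>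
   real^('n + 'p)^'m \<Rightarrow> real^('n + 'p)^'m \<Rightarrow> real^('d::finite \<times> ('n + 'p))^'m \<Rightarrow>
   (real \<Rightarrow> real^('n + 'p)^('d \<times> ('n + 'p))) \<Rightarrow>
   real^('n + 'p)^'p \<Rightarrow> real^('n + 'p)^'p \<Rightarrow> real^('d \<times> ('n + 'p))^'p \<Rightarrow>
   (real \<Rightarrow> real^('n + 'p)) \<Rightarrow> (real \<Rightarrow> real^'q) \<Rightarrow>
   (real \<Rightarrow> real^('n + 'p)) \<Rightarrow> (real \<Rightarrow> real^'m) \<Rightarrow> bool" where
  "cls r t0 A B D1 D2 D3 C1 C2 C3 F K1 K2 K3 \<phi> w x z \<longleftrightarrow>
     continuous_on {-r..0} \<phi> \<and>
     w \<in> borel_measurable (lebesgue_on {t0..}) \<and>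
     integrable (lebesgue_on {t0..}) (\<lambda>t. (norm (w t))\<^sup>2) \<and>
     (\<forall>\<theta>\<in>{-r..0}. x (t0 + \<theta>) = \<phi> \<theta>) \<and>
     (\<forall>T\<ge>t0. abs_cont_on t0 T x) \<and>
     (AE t in lebesgue. t \<ge> t0 \<longrightarrow>
        (x has_vector_derivative
           (((A ||| 0) /// K1) *v x t + ((0 ||| B) /// K2) *v x (t - r)
            + integral {-r..0} (\<lambda>\<tau>. ((0 /// K3) ** F \<tau>) *v x (t + \<tau>))
            + (D1 /// D2) *v w t)) (at t)) \<and>
     (AE t in lebesgue. t \<ge> t0 \<longrightarrow>
        z t = C1 *v x t + C2 *v x (t - r)
              + integral {-r..0} (\<lambda>\<tau>. (C3 ** F \<tau>) *v x (t + \<tau>)) + D3 *v w t)"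

definition supply_rate ::
  "real^'m^'m \<Rightarrow> real^'m^'m \<Rightarrow> real^'q^'m \<Rightarrow> real^'q^'q \<Rightarrow> real^'m \<Rightarrow> real^'q \<Rightarrow> real" where
  "supply_rate Jt J1 J2 J3 z w =
     vec_join z w \<bullet> (((transpose Jt ** matrix_inv J1 ** Jt ||| J2) /// (transpose J2 ||| J3)) *v vec_join z w)"

definition segment_at :: "real \<Rightarrow> (real \<Rightarrow> 'a) \<Rightarrow> real \<Rightarrow> real \<Rightarrow> 'a" where
  "segment_at r x t = restrict (\<lambda>\<theta>. x (t + \<theta>)) {-r..0}"

text \<open>The state space \<open>C([-r, 0])\<close> with the supremum norm is the metric space
  \<open>cfunspace\<close>, whose points are extensional functions. The parameter \<open>S\<close> is a system in the sense of the set of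
  its trajectories, as given by \<open>cls\<close>.\<close>

definition dissipative ::
  "real \<Rightarrow> real \<Rightarrow>
   ((real \<Rightarrow> real^'k) \<Rightarrow> (real \<Rightarrow> real^'q) \<Rightarrow> (real \<Rightarrow> real^'k) \<Rightarrow> (real \<Rightarrow> real^'m) \<Rightarrow> bool) \<Rightarrow>
   (real^'m \<Rightarrow> real^'q \<Rightarrow> real) \<Rightarrow> bool" where
  "dissipative r t0 S s \<longleftrightarrow>
     (\<exists>v :: (real \<Rightarrow> real^'k) \<Rightarrow> real.
        continuous_map (mtopology_of (cfunspace (top_of_set {-r..0}) euclidean_metric)) euclidean v \<and>
        (\<forall>\<phi> w x z. S \<phi> w x z \<longrightarrow>
           (AE t in lebesgue. t \<ge> t0 \<longrightarrow>
              (\<exists>D. ((\<lambda>t. v (segment_at r x t)) has_real_derivative D) (at t) \<and>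
                   D - s (z t) (w t) \<le> 0))))"

definition zero_exp_stable ::
  "real \<Rightarrow> real \<Rightarrow>
   ((real \<Rightarrow> real^'k) \<Rightarrow> (real \<Rightarrow> real^'q) \<Rightarrow> (real \<Rightarrow> real^'k) \<Rightarrow> (real \<Rightarrow> real^'m) \<Rightarrow> bool) \<Rightarrow> bool" where
  "zero_exp_stable r t0 S \<longleftrightarrow>
     (\<exists>\<alpha>>0. \<exists>\<beta>>0. \<forall>\<phi> x z. S \<phi> (\<lambda>_. 0) x z \<longrightarrow>
        (\<forall>t\<ge>t0. norm (x t) \<le> \<beta> * exp (- \<alpha> * (t - t0)) * (SUP \<theta>\<in>{-r..0}. norm (\<phi> \<theta>))))"

text \<open>Index type of \<open>(\<chi>(t), \<chi>(t-r), \<integral>F \<chi>, w)\<close>, where \<open>'k\<close> is the index type of \<open>\<chi>\<close>.\<close>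

type_synonym ('k, 'd, 'q) aug = "'k + 'k + ('d \<times> 'k) + 'q"

text \<open>A zero block of the original formula which spans several components of this index type
  (such as the one between \<open>A\<close> and \<open>B\<close>, or one of width \<open>q + m\<close>) is split accordingly.\<close>

definition bold_A ::
  "real^'n^'n \<Rightarrow> real^'p^'n \<Rightarrow> real^'q^'n \<Rightarrow> real^'q^'p \<Rightarrow> real^('n + 'p, 'd::finite, 'q) aug^('n + 'p)" where
  "bold_A A B D1 D2 =
     ((A ||| 0) ||| (0 ||| B) ||| 0 ||| D1) ///
     ((0 ||| 0) ||| (0 ||| 0) ||| 0 ||| D2)"

definition bold_B :: "real^'p^('n::finite + 'p)" where
  "bold_B = 0 /// mat 1"

definition bold_K ::
  "real^'k^'p \<Rightarrow> real^'k^'p \<Rightarrow> real^('d::finite \<times> 'k)^'p \<Rightarrow> real^('k, 'd, 'q::finite) aug^'p" where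
  "bold_K K1 K2 K3 = K1 ||| K2 ||| K3 ||| 0"

definition bold_Pi ::
  "real^'n^'n \<Rightarrow> real^'p^'n \<Rightarrow> real^'q^'n \<Rightarrow> real^'q^'p \<Rightarrow>
   real^('n + 'p)^'p \<Rightarrow> real^('n + 'p)^'p \<Rightarrow> real^('d::finite \<times> ('n + 'p))^'p \<Rightarrow>
   real^('n + 'p, 'd, 'q) aug^('n + 'p)" where
  "bold_Pi A B D1 D2 K1 K2 K3 = bold_A A B D1 D2 + bold_B ** bold_K K1 K2 K3"

definition bold_P ::
  "real^'k^'k \<Rightarrow> real^('d::finite \<times> 'k)^'k \<Rightarrow> real^(('k, 'd, 'q::finite) aug + 'm::finite)^'k" where
  "bold_P P Q = (P ||| 0 ||| Q ||| 0) ||| 0"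

definition bold_F ::
  "real \<Rightarrow> (real \<Rightarrow> real^'d) \<Rightarrow> real^'d^'d \<Rightarrow> real^('k::finite, 'd, 'q::finite) aug^('d \<times> 'k)" where
  "bold_F r f M =
     Fker r f 0 ||| - Fker r f (-r)
     ||| - ((mat_sqrt (matrix_inv (gram r f)) ** M ** mat_sqrt (gram r f)) \<otimes> mat 1) ||| 0"

definition bold_Sigma ::
  "real^'k^'m \<Rightarrow> real^'k^'m \<Rightarrow> real^('d::finite \<times> 'k)^'m \<Rightarrow> real^'q^'m \<Rightarrow> real^('k, 'd, 'q) aug^'m" where
  "bold_Sigma C1 C2 C3 D3 = C1 ||| C2 ||| C3 ||| D3"

definition bold_Phi ::
  "real \<Rightarrow> real^('k, 'd::finite, 'q) aug^('d \<times> 'k) \<Rightarrow> real^('k, 'd, 'q) aug^'m \<Rightarrow>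
   real^'m^'m \<Rightarrow> real^'m^'m \<Rightarrow> real^'q^'m \<Rightarrow> real^'q^'q \<Rightarrow>
   real^('d \<times> 'k)^'k \<Rightarrow> real^('d \<times> 'k)^('d \<times> 'k) \<Rightarrow> real^'k^'k \<Rightarrow> real^'k^'k \<Rightarrow>
   real^(('k, 'd, 'q) aug + 'm)^(('k, 'd, 'q) aug + 'm)" where
  "bold_Phi r FF \<Sigma> Jt J1 J2 J3 Q R S U =
     Sy (((Q /// 0 /// R /// 0) /// 0) ** (FF ||| 0))
     + (((S + r *\<^sub>R U) \<oplus> (- S) \<oplus> (- (mat 1 \<otimes> U)) \<oplus> (- J3)) \<oplus> J1)
     + Sy (transpose ((0 ||| 0 ||| 0 ||| - J2) ||| transpose Jt) ** (\<Sigma> ||| 0))"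

type_synonym ('k, 'p, 'd) unknowns =
  "(real^'k^'k) \<times> (real^('d \<times> 'k)^'k) \<times> (real^('d \<times> 'k)^('d \<times> 'k)) \<times> (real^'k^'k) \<times> (real^'k^'k) \<times>
   (real^'k^'p) \<times> (real^'k^'p) \<times> (real^('d \<times> 'k)^'p)"

text \<open>The linear space in which \<open>(P, Q, R, S, U, K1, K2, K3)\<close> ranges. Its dimension is the number of
  scalar unknowns: a symmetric \<open>k \<times> k\<close> matrix contributes \<open>k (k + 1) / 2\<close> of them.\<close>

definition unknowns_space :: "('k::finite, 'p::finite, 'd::finite) unknowns set" where
  "unknowns_space =
     {(P, Q, R, S, U, K1, K2, K3). sym_mat P \<and> sym_mat R \<and> sym_mat S \<and> sym_mat U}"

end

theory Submission
  imports Defs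
begin

text \<open>
  The storage function is the Krasovskii functional
  \<open>v(\<phi>) = \<phi>(0)\<^sup>T P \<phi>(0) + 2 \<phi>(0)\<^sup>T Q y + y\<^sup>T R y + \<integral> \<phi>(\<tau>)\<^sup>T (S + (\<tau> + r) U) \<phi>(\<tau>) d\<tau>\<close> with
  \<open>y = \<integral> F(\<tau>) \<phi>(\<tau>) d\<tau>\<close>. Because \<open>f' = M f\<close>, the derivative of \<open>y\<close> along a trajectory is linear in
  \<open>(x(t), x(t - r), y)\<close>, so the derivative of \<open>v\<close> is a quadratic form in these variables and \<open>w\<close>, minus
  \<open>\<integral> x\<^sup>T U x\<close>. The entries of \<open>mat_sqrt (matrix_inv (gram r f)) *v f\<close> are orthonormal in
  \<open>L\<^sup>2\<close>, hence Bessel's inequality bounds this integral below by \<open>y\<^sup>T (I \<otimes> U) y\<close>, and likewise makes \<open>v\<close> coercive in \<open>\<phi>(0)\<close>. The matrix inequality is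
  the Schur complement form of negativity of the resulting quadratic form minus the supply rate.
  For \<open>w = 0\<close> the trajectories are continuously differentiable, because absolutely continuous functions
  satisfy the fundamental theorem of calculus; part of \<open>\<integral> x\<^sup>T U x\<close> is kept to get
  \<open>v' + \<alpha> v \<le> 0\<close>.
\<close>

section \<open>Block matrices\<close>

text \<open>A trajectory is differentiable only almost everywhere, and
  \<open>v' + \<alpha> v \<le> 0\<close> almost everywhere yields no decay unless v is absolutely
  continuous along it. Continuous differentiability for zero disturbance avoids this question: the
  inequality then holds at every time, and ordinary monotonicity suffices. Dissipativity is itself
  an almost-everywhere statement and needs no such step. Derivatives are first taken within [t0,
  infinity), because the initial function is merely continuous and only a one-sided derivative
  exists at t0. The delayed integrals cause no loss of smoothness: they are differentiable at every
  time although their integrand x is only continuous. Definiteness enters through uniform constants.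
  Strictness of the matrix inequality leaves a margin e > 0 in x(t) and y, and this margin pays for
  the decay rate. As \<open>mat_sqrt\<close> is a definite description, existence and uniqueness of
  the positive definite root have to be proved before anything is known about the kernel F.\<close>

lemma vec_join_Inl [simp]: "vec_join x y $ Inl i = x $ i"
  and vec_join_Inr [simp]: "vec_join x y $ Inr j = y $ j"
  by (simp_all add: vec_join_def)

lemma sum_UNIV_Plus: "(\<Sum>i\<in>UNIV. g i) = (\<Sum>i\<in>UNIV. g (Inl i)) + (\<Sum>j\<in>UNIV. g (Inr j))"
  for g :: "'a::finite + 'b::finite \<Rightarrow> 'c::comm_monoid_add"
  by (simp add: UNIV_Plus_UNIV[symmetric] sum.Plus del: UNIV_Plus_UNIV)

lemma vec_join_inner [simp]: "vec_join x y \<bullet> vec_join x' y' = x \<bullet> x' + y \<bullet> y'"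
  by (simp add: inner_vec_def sum_UNIV_Plus)

lemma vec_join_add [simp]: "vec_join x y + vec_join x' y' = vec_join (x + x') (y + y')"
  by (simp add: vec_eq_iff vec_join_def split: sum.split)

lemma norm_vec_join: "(norm (vec_join x y))\<^sup>2 = (norm x)\<^sup>2 + (norm y)\<^sup>2"
  for x :: "real^'a" and y :: "real^'b"
  by (simp add: power2_norm_eq_inner)

lemma hcat_mult_vec_join [simp]: "(X ||| Y) *v vec_join x y = X *v x + Y *v y"
  for X :: "real^'a^'m"
  by (simp add: vec_eq_iff matrix_vector_mult_def hcat_def sum_UNIV_Plus)

lemma vcat_mult_vec [simp]: "(X /// Y) *v x = vec_join (X *v x) (Y *v x)"
  for X :: "real^'k^'m"
  by (auto simp: vec_eq_iff matrix_vector_mult_def vcat_def vec_join_def split: sum.split)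

lemma hcat_zero [simp]: "(0 ||| 0) = 0"
  by (auto simp: hcat_def vec_eq_iff split: sum.split)

lemma dsum_mult_vec_join [simp]: "(X \<oplus> Y) *v vec_join x y = vec_join (X *v x) (Y *v y)"
  by (simp add: dsum_def)

lemma inner_matrix_transpose: "x \<bullet> (Y *v y) = (transpose Y *v x) \<bullet> y"
  for Y :: "real^'a^'b"
  by (metis dot_lmul_matrix vector_transpose_matrix transpose_transpose matrix_transpose_mul transpose_matrix_vector)

lemma Sy_form [simp]: "x \<bullet> (Sy Y *v x) = 2 * (x \<bullet> (Y *v x))"
  using inner_matrix_transpose[of x "transpose Y" x]
  by (simp add: Sy_def matrix_vector_mult_add_rdistrib inner_add_right inner_commute)

lemma sym_mat_inner_commute: "sym_mat W \<Longrightarrow> u \<bullet> (W *v v) = v \<bullet> (W *v u)"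
  using inner_matrix_transpose[of u W v] unfolding sym_mat_def by (simp only: inner_commute)

lemma uminus_matrix_vector_mult [simp]: "(- Y) *v x = - (Y *v x)" for Y :: "real^'a^'b"
  by (simp add: vec_eq_iff matrix_vector_mult_def sum_negf)

lemma scaleR_matrix_vector_mult [simp]: "(c *\<^sub>R Y) *v x = c *\<^sub>R (Y *v x)" for Y :: "real^'a^'b"
  by (simp add: scaleR_matrix_vector_assoc)

lemma bounded_bilinear_matrix_vector_mult:
  "bounded_bilinear ((*v) :: real^'a^'b \<Rightarrow> real^'a \<Rightarrow> real^'b)"
  unfolding bilinear_conv_bounded_bilinear[symmetric] bilinear_def
  by (auto intro!: linearI simp: algebra_simps matrix_vector_mult_scaleR)

lemma matrix_vector_mult_minus: "Y *v (- x) = - (Y *v x)" for Y :: "real^'a^'b"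
  by (rule linear_neg[OF matrix_vector_mul_linear])

text \<open>Cuts a vector over the product index into its blocks of type \<open>real^'k\<close>. The
  left factor of a Kronecker product mixes the blocks, the right factor acts inside each; in
  particular \<open>mat 1 \<otimes> W\<close> applies W to every block.\<close>

definition blk :: "real^('d::finite \<times> 'k::finite) \<Rightarrow> 'd \<Rightarrow> real^'k" where
  "blk y i = (\<chi> k. y $ (i, k))"

lemma sum_UNIV_prod: "(\<Sum>ik\<in>UNIV. g ik) = (\<Sum>i\<in>UNIV. \<Sum>k\<in>UNIV. g (i, k))"
  for g :: "'a::finite \<times> 'b::finite \<Rightarrow> 'c::comm_monoid_add"
  by (simp add: UNIV_Times_UNIV[symmetric] sum.cartesian_product del: UNIV_Times_UNIV)

lemma blk_kron: "blk ((Y \<otimes> W) *v y) i = (\<Sum>j\<in>UNIV. Y $ i $ j *\<^sub>R (W *v blk y j))"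
  by (simp add: vec_eq_iff blk_def kron_def matrix_vector_mult_def sum_UNIV_prod sum_distrib_left mult.assoc)

lemma inner_eq_sum_blk: "x \<bullet> y = (\<Sum>i\<in>UNIV. blk x i \<bullet> blk y i)"
  by (simp add: inner_vec_def blk_def sum_UNIV_prod)

lemma blk_mat1_kron [simp]: "blk ((mat 1 \<otimes> W) *v y) i = W *v blk y i"
proof -
  have "blk ((mat 1 \<otimes> W) *v y) i = (\<Sum>j\<in>UNIV. if j = i then W *v blk y j else 0)"
    unfolding blk_kron by (intro sum.cong) (auto simp: mat_def)
  then show ?thesis by simp
qed

lemma blk_vkron [simp]: "blk (vkron v (mat 1) *v x) i = v $ i *\<^sub>R x"
proof -
  have "blk (vkron v (mat 1) *v x) i $ k = v $ i * x $ k" for k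
  proof -
    have "blk (vkron v (mat 1) *v x) i $ k = (\<Sum>l\<in>UNIV. v $ i * (if k = l then 1 else 0) * x $ l)"
      by (simp add: blk_def vkron_def matrix_vector_mult_def mat_def)
    also have "\<dots> = (\<Sum>l\<in>UNIV. if l = k then v $ i * x $ l else 0)"
      by (intro sum.cong) auto
    finally show ?thesis by simp
  qed
  then show ?thesis by (simp add: vec_eq_iff)
qed

lemma blk_eq_iff: "x = y \<longleftrightarrow> (\<forall>i. blk x i = blk y i)"
  by (auto simp: vec_eq_iff blk_def)

text \<open>The constant is the minimum of the form over the unit sphere: attained by compactness,
  positive by definiteness, and carried to all vectors by homogeneity.\<close>

lemma pos_defD_coercive:
  fixes X :: "real^'k^'k"
  assumes "pos_def X"
  obtains c where "c > 0" "\<And>v. v \<bullet> (X *v v) \<ge> c * (norm v)\<^sup>2"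
proof -
  have "continuous_on (sphere 0 1) (\<lambda>v. v \<bullet> (X *v v))"
    by (intro continuous_intros linear_continuous_on) (simp add: matrix_vector_mul_bounded_linear)
  moreover have "sphere (0::real^'k) 1 \<noteq> {}"
    by simp
  moreover note compact_sphere[of "0::real^'k" 1]
  ultimately obtain u where u: "u \<in> sphere 0 1" "\<And>v. v \<in> sphere 0 1 \<Longrightarrow> u \<bullet> (X *v u) \<le> v \<bullet> (X *v v)"
    using continuous_attains_inf[of "sphere (0::real^'k) 1" "\<lambda>v. v \<bullet> (X *v v)"] by blast
  define c where "c = u \<bullet> (X *v u)"
  have "u \<noteq> 0" using u by auto
  then have "c > 0"
    using assms by (auto simp: pos_def_def c_def)
  moreover have "v \<bullet> (X *v v) \<ge> c * (norm v)\<^sup>2" for v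
  proof (cases "v = 0")
    case False
    then have "c \<le> (inverse (norm v) *\<^sub>R v) \<bullet> (X *v (inverse (norm v) *\<^sub>R v))"
      unfolding c_def by (intro u) simp
    also have "\<dots> = (v \<bullet> (X *v v)) / (norm v)\<^sup>2"
      by (simp add: matrix_vector_mult_scaleR field_simps power2_eq_square)
    finally show ?thesis using False by (simp add: field_simps)
  qed simp
  ultimately show ?thesis using that by blast
qed

lemma neg_defD_coercive:
  fixes X :: "real^'k^'k"
  assumes "neg_def X"
  obtains c where "c > 0" "\<And>v. v \<bullet> (X *v v) \<le> - c * (norm v)\<^sup>2"
proof -
  have "transpose (- X) = - transpose X"
    by (simp add: transpose_def vec_eq_iff)
  then have "pos_def (- X)"
    using assms by (simp add: neg_def_def pos_def_def sym_mat_def)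
  then obtain c where "c > 0" "\<And>v. v \<bullet> ((- X) *v v) \<ge> c * (norm v)\<^sup>2"
    using pos_defD_coercive by blast
  then show ?thesis using that[of c] by (simp add: le_minus_iff)
qed

lemma quadratic_form_bound:
  fixes X :: "real^'k^'k"
  obtains c where "c > 0" "\<And>v. v \<bullet> (X *v v) \<le> c * (norm v)\<^sup>2"
proof -
  \<comment> \<open>The summand 1 keeps the constant positive even for X = 0; later rates are
    quotients by such constants.\<close>
  define c where "c = 1 + onorm ((*v) X)"
  have "v \<bullet> (X *v v) \<le> c * (norm v)\<^sup>2" for v
  proof -
    have "v \<bullet> (X *v v) \<le> norm v * norm (X *v v)" by (rule norm_cauchy_schwarz)
    also have "\<dots> \<le> norm v * (onorm ((*v) X) * norm v)"
      by (intro mult_left_mono onorm matrix_vector_mul_bounded_linear) auto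
    also have "\<dots> \<le> c * (norm v)\<^sup>2"
      by (simp add: c_def power2_eq_square algebra_simps)
    finally show ?thesis .
  qed
  moreover have "c > 0"
    using onorm_pos_le[OF matrix_vector_mul_bounded_linear[of X]] by (simp add: c_def)
  ultimately show ?thesis using that by blast
qed

section \<open>Square roots of positive definite matrices\<close>

text \<open>Polarisation expresses u . T w for self-adjoint T by two values of the quadratic form,
  and the parallelogram law collects the resulting squares.\<close>

lemma self_adjoint_norm_le:
  fixes T :: "'a::real_inner \<Rightarrow>\<^sub>L 'a"
  assumes sa: "\<And>u v. T u \<bullet> v = u \<bullet> T v"
    and bound: "\<And>u. \<bar>u \<bullet> T u\<bar> \<le> k * (norm u)\<^sup>2"
    and "k \<ge> 0"
  shows "norm T \<le> k"
proof (rule norm_blinfun_bound)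
  fix w :: 'a
  have polar: "4 * (u \<bullet> T w) \<le> 2 * k * ((norm u)\<^sup>2 + (norm w)\<^sup>2)" for u
  proof -
    have "4 * (u \<bullet> T w) = (u + w) \<bullet> T (u + w) - (u - w) \<bullet> T (u - w)"
      using sa[of w u] by (simp add: blinfun.add_right blinfun.diff_right inner_simps inner_commute)
    also have "\<dots> \<le> k * (norm (u + w))\<^sup>2 + k * (norm (u - w))\<^sup>2"
      using bound[of "u + w"] bound[of "u - w"] by linarith
    also have "\<dots> = 2 * k * ((norm u)\<^sup>2 + (norm w)\<^sup>2)"
      by (simp add: power2_norm_eq_inner inner_simps inner_commute algebra_simps)
    finally show ?thesis .
  qed
  show "norm (T w) \<le> k * norm w"
  proof (cases "T w = 0 \<or> w = 0")
    case True
    then show ?thesis using \<open>k \<ge> 0\<close> by auto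
  next
    case False
    \<comment> \<open>Here u is T w rescaled to the length of w, so that both squares on the right
      of \<open>polar\<close> agree.\<close>
    have "4 * (norm w * norm (T w)) \<le> 4 * (norm w * (k * norm w))"
      using polar[of "(norm w / norm (T w)) *\<^sub>R T w"] False
      by (simp add: power2_norm_eq_inner[symmetric] power2_eq_square field_simps)
    then show ?thesis using False by simp
  qed
qed (fact \<open>k \<ge> 0\<close>)

text \<open>The equation $(1 - Z)^2 = 1 - T$ in fixed-point form.\<close>

lemma self_adjoint_sqrt_fixpoint:
  fixes T :: "'a::{real_inner, banach} \<Rightarrow>\<^sub>L 'a"
  assumes sa: "\<And>u v. T u \<bullet> v = u \<bullet> T v"
    and bound: "\<And>u. \<bar>u \<bullet> T u\<bar> \<le> k * (norm u)\<^sup>2"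
    and k: "0 \<le> k" "k < 1"
  obtains Z :: "'a \<Rightarrow>\<^sub>L 'a" where "\<And>u v. Z u \<bullet> v = u \<bullet> Z v" "norm Z < 1" "Z = (1 / 2) *\<^sub>R (T + (Z o\<^sub>L Z))"
proof -
  \<comment> \<open>The smaller root of \<open>k + \<rho> * \<rho> = 2 * \<rho>\<close>. This
    equation makes the ball of radius \<rho> invariant under \<Phi>, and \<rho> < 1 is also the
    contraction factor there.\<close>
  define \<rho> where "\<rho> = 1 - sqrt (1 - k)"
  have \<rho>: "0 \<le> \<rho>" "\<rho> < 1" using k by (auto simp: \<rho>_def)
  have \<rho>_eq: "k + \<rho> * \<rho> = 2 * \<rho>"
    using k by (simp add: \<rho>_def algebra_simps)
  define \<Phi> where "\<Phi> Z = (1 / 2) *\<^sub>R (T + (Z o\<^sub>L Z))" for Z :: "'a \<Rightarrow>\<^sub>L 'a"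
  \<comment> \<open>Self-adjointness is built into the domain, which stays closed and hence
    complete; the fixed point inherits it.\<close>
  define D where "D = {Z :: 'a \<Rightarrow>\<^sub>L 'a. \<forall>u v. Z u \<bullet> v = u \<bullet> Z v} \<inter> cball 0 \<rho>"
  have "norm T \<le> k" by (rule self_adjoint_norm_le) (use assms in auto)
  have "closed {Z :: 'a \<Rightarrow>\<^sub>L 'a. \<forall>u v. Z u \<bullet> v = u \<bullet> Z v}"
    by (intro closed_Collect_all closed_Collect_eq continuous_intros)
  then have "complete D"
    by (simp add: D_def complete_eq_closed closed_Int)
  moreover have "0 \<in> D"
    using \<rho> by (simp add: D_def)
  then have "D \<noteq> {}" by blast
  moreover have "\<Phi> ` D \<subseteq> D"
  proof safe
    fix Z assume Z: "Z \<in> D"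
    have "\<Phi> Z u \<bullet> v = u \<bullet> \<Phi> Z v" for u v
      using Z sa by (simp add: D_def \<Phi>_def blinfun.scaleR_left blinfun.add_left inner_simps)
    moreover have "norm (\<Phi> Z) \<le> \<rho>"
    proof -
      have nZ: "norm Z \<le> \<rho>" using Z by (simp add: D_def)
      have "norm (Z o\<^sub>L Z) \<le> norm Z * norm Z" by (rule norm_blinfun_compose)
      also have "\<dots> \<le> \<rho> * \<rho>" using nZ \<rho> by (intro mult_mono) auto
      finally have "norm (T + (Z o\<^sub>L Z)) \<le> k + \<rho> * \<rho>"
        using \<open>norm T \<le> k\<close> norm_triangle_ineq[of T "Z o\<^sub>L Z"] by linarith
      then show ?thesis using \<rho>_eq by (simp add: \<Phi>_def)
    qed
    ultimately show "\<Phi> Z \<in> D" by (simp add: D_def)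
  qed
  moreover have "dist (\<Phi> Z) (\<Phi> W) \<le> \<rho> * dist Z W" if "Z \<in> D" "W \<in> D" for Z W
  proof -
    have "(Z o\<^sub>L Z) - (W o\<^sub>L W) = (Z o\<^sub>L (Z - W)) + ((Z - W) o\<^sub>L W)"
      by (auto intro!: blinfun_eqI simp: blinfun.diff_left blinfun.add_left blinfun.diff_right)
    then have "norm ((Z o\<^sub>L Z) - (W o\<^sub>L W)) \<le> norm (Z o\<^sub>L (Z - W)) + norm ((Z - W) o\<^sub>L W)"
      by (simp add: norm_triangle_ineq)
    also have "\<dots> \<le> norm Z * norm (Z - W) + norm (Z - W) * norm W"
      by (intro add_mono norm_blinfun_compose)
    also have "\<dots> \<le> \<rho> * norm (Z - W) + norm (Z - W) * \<rho>"
      using that \<rho>(1) by (intro add_mono mult_mono) (auto simp: D_def)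
    finally have "norm ((Z o\<^sub>L Z) - (W o\<^sub>L W)) \<le> 2 * (\<rho> * dist Z W)"
      by (simp add: dist_norm)
    moreover have "\<Phi> Z - \<Phi> W = (1 / 2) *\<^sub>R ((Z o\<^sub>L Z) - (W o\<^sub>L W))"
      by (simp add: \<Phi>_def algebra_simps)
    ultimately show ?thesis by (simp add: dist_norm)
  qed
  ultimately obtain Z where "Z \<in> D" "\<Phi> Z = Z"
    using Banach_fix[of D \<rho> \<Phi>] \<rho> by blast
  then show ?thesis using that[of Z] \<rho> by (auto simp: D_def \<Phi>_def)
qed

text \<open>Scaling reduces the root of X to that of 1 - T with T = 1 - s X small. If (1 - Z)^2 = 1
  - T, then (1 - Z) / sqrt s squares to X, and it is positive definite because
  \<open>norm Z < 1\<close>.\<close>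

lemma pos_def_sqrt_exists:
  fixes X :: "real^'k^'k"
  assumes "pos_def X"
  obtains Y where "pos_def Y" "Y ** Y = X"
proof -
  have symX: "transpose X = X" using assms by (simp add: pos_def_def sym_mat_def)
  obtain c where c: "c > 0" "\<And>v. v \<bullet> (X *v v) \<ge> c * (norm v)\<^sup>2"
    using pos_defD_coercive[OF assms] by blast
  obtain b where b: "b > 0" "\<And>v. v \<bullet> (X *v v) \<le> b * (norm v)\<^sup>2"
    using quadratic_form_bound[of X] by blast
  \<comment> \<open>\<open>s * b \<le> 1\<close> makes the form of T nonnegative, while
    \<open>s * c\<close> lies strictly between 0 and 1, so that \<open>1 - s * c\<close> is an
    admissible k for the fixed-point lemma.\<close>
  define s where "s = 1 / (b + c)"
  have s: "s > 0" "s * c < 1" "s * b \<le> 1" using b c by (auto simp: s_def field_simps)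
  define T where "T = Blinfun (\<lambda>v. v - s *\<^sub>R (X *v v))"
  have T: "T v = v - s *\<^sub>R (X *v v)" for v
    unfolding T_def
    by (subst bounded_linear_Blinfun_apply)
      (auto intro!: bounded_linear_intros matrix_vector_mul_bounded_linear)
  have "T u \<bullet> v = u \<bullet> T v" for u v
    using inner_matrix_transpose[of u X v] by (simp add: T inner_diff_left inner_diff_right symX)
  moreover have "\<bar>u \<bullet> T u\<bar> \<le> (1 - s * c) * (norm u)\<^sup>2" for u
  proof -
    have "s * (u \<bullet> (X *v u)) \<le> s * (b * (norm u)\<^sup>2)"
      using s b(2)[of u] by (intro mult_left_mono) auto
    also have "\<dots> \<le> 1 * (norm u)\<^sup>2"
      unfolding mult.assoc[symmetric] using s by (intro mult_right_mono) auto
    finally have "s * (u \<bullet> (X *v u)) \<le> (norm u)\<^sup>2" by simp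
    moreover have "s * (c * (norm u)\<^sup>2) \<le> s * (u \<bullet> (X *v u))"
      using s c(2)[of u] by (intro mult_left_mono) auto
    ultimately show ?thesis
      by (simp add: T inner_diff_right power2_norm_eq_inner algebra_simps)
  qed
  moreover have "0 \<le> 1 - s * c" "1 - s * c < 1" using s c by auto
  ultimately obtain Z :: "(real^'k) \<Rightarrow>\<^sub>L (real^'k)" where Z: "\<And>u v. Z u \<bullet> v = u \<bullet> Z v" "norm Z < 1" "Z = (1 / 2) *\<^sub>R (T + (Z o\<^sub>L Z))"
    using self_adjoint_sqrt_fixpoint[of T "1 - s * c"] by blast
  define Y where "Y = matrix (\<lambda>v. (1 / sqrt s) *\<^sub>R (v - Z v))"
  have Y: "Y *v v = (1 / sqrt s) *\<^sub>R (v - Z v)" for v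
  proof -
    have "bounded_linear (\<lambda>v. (1 / sqrt s) *\<^sub>R (v - Z v))"
      by (intro bounded_linear_intros)
    from fun_cong[OF matrix_vector_mul(3)[OF this]] show ?thesis by (simp add: Y_def)
  qed
  have "transpose Y *v u = Y *v u" for u
  proof -
    have "(transpose Y *v u) \<bullet> v = (Y *v u) \<bullet> v" for v
      unfolding inner_matrix_transpose[symmetric]
      using Z(1)[of u v] by (simp add: Y inner_diff_left inner_diff_right)
    then show ?thesis using vector_eq_rdot by blast
  qed
  then have "sym_mat Y" by (simp add: sym_mat_def matrix_eq)
  moreover have "v \<bullet> (Y *v v) > 0" if "v \<noteq> 0" for v
  proof -
    have "v \<bullet> Z v \<le> norm v * norm (Z v)" by (rule norm_cauchy_schwarz)
    also have "\<dots> \<le> norm v * (norm Z * norm v)" by (intro mult_left_mono norm_blinfun) auto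
    also have "\<dots> < norm v * (1 * norm v)"
      using Z(2) that by (intro mult_strict_left_mono mult_strict_right_mono) auto
    also have "\<dots> = v \<bullet> v" by (simp add: power2_norm_eq_inner[symmetric] power2_eq_square)
    finally show ?thesis using s by (simp add: Y inner_diff_right)
  qed
  ultimately have "pos_def Y" by (simp add: pos_def_def)
  moreover have "Y ** Y = X"
  proof (subst matrix_eq, intro allI)
    fix v
    have "2 *\<^sub>R Z v = T v + Z (Z v)"
      by (subst Z(3)) (simp add: blinfun.scaleR_left blinfun.add_left)
    then have "v - Z v - Z (v - Z v) = s *\<^sub>R (X *v v)"
      by (simp add: T blinfun.diff_right algebra_simps scaleR_2)
    then have "(1 / s) *\<^sub>R (v - Z v - Z (v - Z v)) = X *v v" using s by simp
    then show "(Y ** Y) *v v = X *v v"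
      using s by (simp add: matrix_vector_mul_assoc[symmetric] Y blinfun.scaleR_right scaleR_diff_right[symmetric])
  qed
  ultimately show ?thesis using that by blast
qed

text \<open>With $E = Y - Z$ one has $E Y + Z E = 0$, so $E E Y + E Z E = 0$; taking the trace gives
  a sum of two nonnegative terms.\<close>

lemma pos_def_sqrt_unique:
  fixes Y Z :: "real^'k^'k"
  assumes "pos_def Y" "pos_def Z" "Y ** Y = Z ** Z"
  shows "Y = Z"
proof -
  define E where "E = Y - Z"
  have symE: "transpose E = E"
    using assms by (simp add: E_def pos_def_def sym_mat_def transpose_def vec_eq_iff)
  \<comment> \<open>The diagonal entries of E W E are the values of the form of W at the columns of
    E, so the trace can vanish only if all columns do.\<close>
  have pos: "trace (E ** W ** E) \<ge> 0" "trace (E ** W ** E) = 0 \<Longrightarrow> E = 0" if W: "pos_def W" for W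
  proof -
    have entry: "(E ** W ** E) $ i $ i = (E *v axis i 1) \<bullet> (W *v (E *v axis i 1))" for i
    proof -
      have "(E ** W ** E) $ i $ i = axis i 1 \<bullet> ((E ** W ** E) *v axis i 1)"
        by (simp add: inner_axis' matrix_vector_mul_component matrix_vector_mult_basis column_def)
      also have "\<dots> = (E *v axis i 1) \<bullet> (W *v (E *v axis i 1))"
        using inner_matrix_transpose[of "axis i 1" E "W *v (E *v axis i 1)"]
        by (simp add: matrix_vector_mul_assoc matrix_mul_assoc symE)
      finally show ?thesis .
    qed
    have nonneg: "(E ** W ** E) $ i $ i \<ge> 0" for i
      using W unfolding entry pos_def_def by (metis inner_zero_left less_eq_real_def)
    then show "trace (E ** W ** E) \<ge> 0" by (simp add: trace_def sum_nonneg)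
    assume "trace (E ** W ** E) = 0"
    then have "(E ** W ** E) $ i $ i = 0" for i
      using nonneg by (simp add: trace_def sum_nonneg_eq_0_iff)
    then have "E *v axis i 1 = 0" for i
      using W unfolding entry pos_def_def by (metis less_irrefl)
    then show "E = 0"
      by (simp add: matrix_vector_mult_basis column_def vec_eq_iff)
  qed
  \<comment> \<open>The mixed products Z Y cancel, leaving Y Y - Z Z.\<close>
  have "E ** Y + Z ** E = 0"
    using assms(3) by (simp add: E_def matrix_matrix_mult_def vec_eq_iff algebra_simps sum_subtractf)
  then have "E ** (E ** Y) + E ** (Z ** E) = E ** 0"
    by (metis matrix_add_ldistrib)
  also have "\<dots> = 0"
    by (simp add: matrix_matrix_mult_def vec_eq_iff)
  finally have "trace (E ** (E ** Y)) + trace (E ** (Z ** E)) = 0"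
    by (simp add: trace_add[symmetric]) (simp add: trace_def)
  moreover have "trace (E ** (E ** Y)) = trace (E ** Y ** E)"
    by (rule trace_mul_sym)
  ultimately have "trace (E ** Y ** E) = 0"
    using pos(1)[OF assms(1)] pos(1)[OF assms(2)] by (simp add: matrix_mul_assoc)
  then show ?thesis using pos(2)[OF assms(1)] by (simp add: E_def)
qed

lemma mat_sqrt_unique: "pos_def Y \<Longrightarrow> Y ** Y = X \<Longrightarrow> mat_sqrt X = Y"
  unfolding mat_sqrt_def by (rule the_equality) (auto intro: pos_def_sqrt_unique)

lemma
  fixes X :: "real^'k^'k"
  assumes "pos_def X"
  shows pos_def_mat_sqrt: "pos_def (mat_sqrt X)"
    and mat_sqrt_square: "mat_sqrt X ** mat_sqrt X = X"
  using pos_def_sqrt_exists[OF assms] mat_sqrt_unique by metis+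

section \<open>Inverses of positive definite matrices and of their roots\<close>

lemma pos_def_invertible: "pos_def X \<Longrightarrow> invertible X" for X :: "real^'k^'k"
  unfolding pos_def_def invertible_left_inverse matrix_left_invertible_ker
  by (metis inner_zero_right less_irrefl)

lemma matrix_inv_invertible:
  assumes "invertible X"
  shows "X ** matrix_inv X = mat 1" and "matrix_inv X ** X = mat 1"
  using someI_ex[OF assms[unfolded invertible_def]] by (auto simp: matrix_inv_def)

text \<open>The form of the inverse at v equals the form of X at \<open>matrix_inv X *v v\<close>,
  which is nonzero for nonzero v.\<close>

lemma pos_def_matrix_inv:
  fixes X :: "real^'k^'k"
  assumes "pos_def X"
  shows "pos_def (matrix_inv X)"
proof -
  have inv: "X ** matrix_inv X = mat 1" "matrix_inv X ** X = mat 1"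
    using matrix_inv_invertible pos_def_invertible[OF assms] by auto
  have sym: "transpose X = X" using assms by (simp add: pos_def_def sym_mat_def)
  have "transpose (matrix_inv X) ** X = mat 1"
    by (metis inv(1) matrix_transpose_mul sym transpose_mat)
  then have "transpose (matrix_inv X) = matrix_inv X"
    by (metis inv(1) matrix_mul_assoc matrix_mul_lid matrix_mul_rid)
  moreover have "v \<bullet> (matrix_inv X *v v) > 0" if "v \<noteq> 0" for v
  proof -
    have v: "X *v (matrix_inv X *v v) = v"
      by (simp add: matrix_vector_mul_assoc inv)
    then have "matrix_inv X *v v \<noteq> 0" using that by auto
    then have "(matrix_inv X *v v) \<bullet> (X *v (matrix_inv X *v v)) > 0"
      using assms by (simp add: pos_def_def)
    then show ?thesis by (simp add: v inner_commute)
  qed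
  ultimately show ?thesis by (simp add: pos_def_def sym_mat_def)
qed

text \<open>The inverse of the root of X is positive definite and squares to the inverse of X, so
  uniqueness identifies it. Hence the two roots surrounding M in \<open>bold_F\<close> form a
  similarity transformation.\<close>

lemma mat_sqrt_matrix_inv:
  fixes X :: "real^'k^'k"
  assumes "pos_def X"
  shows "mat_sqrt X ** mat_sqrt (matrix_inv X) = mat 1"
    and "mat_sqrt (matrix_inv X) ** mat_sqrt X = mat 1"
proof -
  let ?Y = "mat_sqrt X"
  note Y = pos_def_mat_sqrt[OF assms] mat_sqrt_square[OF assms]
  have inv: "?Y ** matrix_inv ?Y = mat 1" "matrix_inv ?Y ** ?Y = mat 1"
    using matrix_inv_invertible pos_def_invertible[OF Y(1)] by auto
  have "matrix_inv ?Y ** matrix_inv ?Y ** X = mat 1"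
    by (metis Y(2) inv(2) matrix_mul_assoc matrix_mul_lid)
  then have "matrix_inv ?Y ** matrix_inv ?Y = matrix_inv X"
    by (metis assms matrix_inv_invertible(1) matrix_mul_assoc matrix_mul_lid matrix_mul_rid pos_def_invertible)
  then have "mat_sqrt (matrix_inv X) = matrix_inv ?Y"
    by (intro mat_sqrt_unique pos_def_matrix_inv Y)
  with inv show "?Y ** mat_sqrt (matrix_inv X) = mat 1" "mat_sqrt (matrix_inv X) ** ?Y = mat 1"
    by simp_all
qed

section \<open>Absolutely continuous functions\<close>

text \<open>In the gauge integral the integrability of h is part of the conclusion. Intervals tagged
  outside N are controlled by differentiability at the tag, with error proportional to their length.
  Intervals tagged in N are forced into an open set of small measure, where absolute continuity
  bounds the total increment of g.\<close>

lemma abs_cont_on_has_integral_deriv: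
  fixes g :: "real \<Rightarrow> 'a::real_normed_vector"
  assumes "a \<le> b" and ac: "abs_cont_on a b g" and N: "N \<in> null_sets lebesgue"
    and deriv: "\<And>t. t \<in> {a..b} - N \<Longrightarrow> (g has_vector_derivative h t) (at t within {a..b})"
  shows "(h has_integral (g b - g a)) {a..b}"
proof -
  \<comment> \<open>With value 0 on N, tags in N contribute nothing to a Riemann sum, and only the
    increments of g over their intervals remain.\<close>
  define h0 where "h0 t = (if t \<in> N then 0 else h t)" for t
  have "(h0 has_integral (g b - g a)) {a..b}"
    unfolding has_integral_real
  proof (intro allI impI)
    fix e :: real assume "e > 0"
    \<comment> \<open>The added 1 covers a = b and makes the second bound strict.\<close>
    define e1 where "e1 = e / (2 * (b - a + 1))"
    have e1: "e1 > 0" "e1 * (b - a) < e / 2"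
      using \<open>e > 0\<close> \<open>a \<le> b\<close> by (auto simp: e1_def field_simps)
    have "\<forall>t\<in>{a..b} - N. \<exists>d. d > 0 \<and>
        (\<forall>y\<in>{a..b}. \<bar>y - t\<bar> < d \<longrightarrow> norm (g y - g t - (y - t) *\<^sub>R h t) \<le> e1 * \<bar>y - t\<bar>)"
      using deriv e1(1)
      unfolding has_vector_derivative_def has_derivative_within_alt by (auto simp: Ball_def)
    from bchoice[OF this] obtain d where "\<forall>t\<in>{a..b} - N. d t > 0 \<and>
        (\<forall>y\<in>{a..b}. \<bar>y - t\<bar> < d t \<longrightarrow> norm (g y - g t - (y - t) *\<^sub>R h t) \<le> e1 * \<bar>y - t\<bar>)"
      by (rule exE)
    then have d: "t \<in> {a..b} - N \<Longrightarrow> d t > 0"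
      "t \<in> {a..b} - N \<Longrightarrow> y \<in> {a..b} \<Longrightarrow> \<bar>y - t\<bar> < d t
        \<Longrightarrow> norm (g y - g t - (y - t) *\<^sub>R h t) \<le> e1 * \<bar>y - t\<bar>" for t y
      by blast+
    from ac[unfolded abs_cont_on_def, rule_format, OF half_gt_zero[OF \<open>e > 0\<close>]]
    obtain \<delta> where "\<delta> > 0" and \<delta>: "\<forall>I :: (real \<times> real) set.
        finite I \<and> (\<forall>(u, v)\<in>I. a \<le> u \<and> u \<le> v \<and> v \<le> b) \<and>
        pairwise (\<lambda>(u, v) (u', v'). {u<..<v} \<inter> {u'<..<v'} = {}) I \<and>
        (\<Sum>(u, v)\<in>I. v - u) < \<delta> \<longrightarrow> (\<Sum>(u, v)\<in>I. norm (g v - g u)) < e / 2"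
      by (elim exE conjE)
    \<comment> \<open>Outer regularity bounds the measure of V - N; as N is null, V satisfies the
      same bound.\<close>
    obtain V where V: "open V" "N \<subseteq> V" "V - N \<in> lmeasurable" "emeasure lebesgue (V - N) < ennreal \<delta>"
      using sets_lebesgue_outer_open[of N \<delta>] N \<open>\<delta> > 0\<close> by blast
    have "emeasure lebesgue V = emeasure lebesgue (V - N)"
      using N V by (intro emeasure_Diff_null_set[symmetric]) auto
    then have "V \<in> lmeasurable" "measure lebesgue V < \<delta>"
      using V \<open>\<delta> > 0\<close> by (auto simp: fmeasurable_def measure_def enn2real_less_iff)
    \<comment> \<open>Tags in N confine their intervals to V, other tags in [a, b] to the radius of
      differentiability. The last case only completes the gauge on the line.\<close>
    define \<gamma> where "\<gamma> t = (if t \<in> N then V else if t \<in> {a..b} then ball t (d t) else ball t 1)" for t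
    have gauge: "gauge \<gamma>"
      using V d(1) by (auto simp: gauge_def \<gamma>_def)
    have bound: "norm ((\<Sum>(x, K)\<in>p. measure lborel K *\<^sub>R h0 x) - (g b - g a)) < e"
      if p: "p tagged_division_of {a..b}" and fine: "\<gamma> fine p" for p
    proof -
      note pD = tagged_division_ofD[OF p]
      have K_interval: "\<exists>u v. u \<le> v \<and> K = {u..v} \<and> x \<in> {u..v} \<and> {u..v} \<subseteq> {a..b}" if xK: "(x, K) \<in> p" for x K
      proof -
        obtain u v where "K = {u..v}" using pD(4)[OF xK] by auto
        then show ?thesis using pD(2,3)[OF xK] by fastforce
      qed
      define p1 where "p1 = {(x, K). (x, K) \<in> p \<and> x \<in> N}"
      define p2 where "p2 = {(x, K). (x, K) \<in> p \<and> x \<notin> N}"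
      have p12: "p = p1 \<union> p2" "p1 \<inter> p2 = {}" "finite p1" "finite p2"
        using pD(1) by (auto simp: p1_def p2_def intro: finite_subset[of _ p])
      \<comment> \<open>Absolute continuity speaks of sets of endpoint pairs, a tagged division of
        pairs of a tag and an interval; \<open>ends\<close> translates.\<close>
      define ends where "ends = (\<lambda>(x :: real, K :: real set). (Inf K, Sup K))"
      \<comment> \<open>The translation need not be injective. Two members with the same endpoints
        have disjoint interiors, though, hence are degenerate, and sums of terms vanishing on
        degenerate intervals are unaffected.\<close>
      have ends_eq: "u = v" if "(x, K) \<in> p" "(x', K') \<in> p" "(x, K) \<noteq> (x', K')"
        "ends (x, K) = (u, v)" "ends (x', K') = (u, v)" for x K x' K' u v
      proof -
        have "K = {u..v}" "K' = {u..v}" "u \<le> v"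
          using K_interval[OF that(1)] K_interval[OF that(2)] that(4,5) by (auto simp: ends_def)
        then show ?thesis
          using pD(5)[OF that(1,2,3)] by (auto simp: interior_atLeastAtMost_real)
      qed
      have sum_ends: "(\<Sum>(u, v)\<in>ends ` p1. \<Theta> u v) = (\<Sum>(x, K)\<in>p1. \<Theta> (Inf K) (Sup K))"
        if "\<And>u. \<Theta> u u = 0" for \<Theta> :: "real \<Rightarrow> real \<Rightarrow> real"
      proof -
        have "(\<Sum>(u, v)\<in>ends ` p1. \<Theta> u v) = sum ((\<lambda>(u, v). \<Theta> u v) \<circ> ends) p1"
        proof (rule sum.reindex_nontrivial)
          fix q q' assume q: "q \<in> p1" "q' \<in> p1" "q \<noteq> q'" "ends q = ends q'"
          have "fst (ends q) = snd (ends q)"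
            using ends_eq[of "fst q" "snd q" "fst q'" "snd q'"] q by (auto simp: p1_def)
          then show "(case ends q of (u, v) \<Rightarrow> \<Theta> u v) = 0"
            using that by (auto simp: case_prod_beta)
        qed (fact p12)
        then show ?thesis by (simp add: ends_def case_prod_beta comp_def)
      qed
      have "(\<Sum>(u, v)\<in>ends ` p1. norm (g v - g u)) < e / 2"
      proof (rule \<delta>[rule_format], intro conjI)
        show "\<forall>(u, v)\<in>ends ` p1. a \<le> u \<and> u \<le> v \<and> v \<le> b"
        proof clarify
          fix u v x K assume "(u, v) = ends (x, K)" "(x, K) \<in> p1"
          then show "a \<le> u \<and> u \<le> v \<and> v \<le> b"
            using K_interval[of x K] by (auto simp: ends_def p1_def)
        qed
        show "pairwise (\<lambda>(u, v) (u', v'). {u<..<v} \<inter> {u'<..<v'} = {}) (ends ` p1)"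
        proof (rule pairwiseI)
          fix q q' assume q: "q \<in> ends ` p1" "q' \<in> ends ` p1" "q \<noteq> q'"
          then obtain x K x' K' where xK: "(x, K) \<in> p" "(x', K') \<in> p" "q = ends (x, K)" "q' = ends (x', K')"
            by (auto simp: p1_def)
          obtain u v u' v' where "K = {u..v}" "u \<le> v" "K' = {u'..v'}" "u' \<le> v'"
            using K_interval[OF xK(1)] K_interval[OF xK(2)] by blast
          moreover have "interior K \<inter> interior K' = {}"
            using pD(5)[OF xK(1,2)] q(3) xK by auto
          ultimately show "(case q of (u, v) \<Rightarrow> \<lambda>(u', v'). {u<..<v} \<inter> {u'<..<v'} = {}) q'"
            using xK by (simp add: ends_def)
        qed
        \<comment> \<open>The intervals tagged in N divide their union, so their total length is the
          measure of a subset of V.\<close>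
        have div: "snd ` p1 division_of \<Union>(snd ` p1)"
          by (rule division_of_subset[OF division_of_union_self[OF division_of_tagged_division[OF p]]])
            (auto simp: p1_def image_iff)
        have "(\<Sum>(u, v)\<in>ends ` p1. v - u) = (\<Sum>(x, K)\<in>p1. Sup K - Inf K)"
          by (rule sum_ends) simp
        also have "\<dots> = (\<Sum>(x, K)\<in>p1. measure lborel K)"
          using K_interval by (intro sum.cong) (fastforce simp: p1_def)+
        also have "\<dots> = sum (measure lborel \<circ> snd) p1"
          by (simp add: case_prod_beta comp_def)
        also have "\<dots> = sum (measure lborel) (snd ` p1)"
        proof (rule sum.reindex_nontrivial[symmetric])
          fix q q' assume q: "q \<in> p1" "q' \<in> p1" "q \<noteq> q'" "snd q = snd q'"
          obtain x K x' where [simp]: "q = (x, K)" "q' = (x', K)"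
            using q(4) by (cases q; cases q') auto
          obtain u v where "K = {u..v}" "u \<le> v"
            using K_interval[of x K] q by (auto simp: p1_def)
          moreover have "u = v"
            using ends_eq[of x K x' K u v] q calculation by (auto simp: p1_def ends_def)
          ultimately show "measure lborel (snd q) = 0" by simp
        qed (fact p12)
        also have "\<dots> = measure lebesgue (\<Union>(snd ` p1))"
          using content_division[OF div] K_interval
          by (subst content_division[OF div, symmetric], intro sum.cong) (fastforce simp: p1_def)+
        also have "\<dots> \<le> measure lebesgue V"
        proof (rule measure_mono_fmeasurable)
          show "\<Union>(snd ` p1) \<subseteq> V"
            using fine by (fastforce simp: p1_def fine_def \<gamma>_def)
          show "\<Union>(snd ` p1) \<in> sets lebesgue"
            using content_division[OF div] lmeasurable_division[OF div] by blast
        qed fact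
        also note \<open>measure lebesgue V < \<delta>\<close>
        finally show "(\<Sum>(u, v)\<in>ends ` p1. v - u) < \<delta>" .
      qed (use p12 in auto)
      then have p1_less: "(\<Sum>(x, K)\<in>p1. norm (g (Sup K) - g (Inf K))) < e / 2"
        by (subst (asm) sum_ends) auto
      \<comment> \<open>The tag lies between the endpoints, so the linearisation errors on its two
        sides add up to e1 times the length of the interval.\<close>
      have p2_le: "norm (measure lborel K *\<^sub>R h0 x - (g (Sup K) - g (Inf K))) \<le> e1 * measure lborel K" if "(x, K) \<in> p2" for x K
      proof -
        have "(x, K) \<in> p" "x \<notin> N" using that by (auto simp: p2_def)
        then obtain u v where uv: "u \<le> v" "K = {u..v}" "x \<in> {u..v}" "{u..v} \<subseteq> {a..b}"
          using K_interval by blast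
        have "K \<subseteq> \<gamma> x" using fine \<open>(x, K) \<in> p\<close> by (auto simp: fine_def)
        then have "{u..v} \<subseteq> ball x (d x)" using uv \<open>x \<notin> N\<close> by (auto simp: \<gamma>_def)
        moreover have "u \<in> {u..v}" "v \<in> {u..v}" using uv by auto
        ultimately have "u \<in> ball x (d x)" "v \<in> ball x (d x)" by blast+
        then have "\<bar>u - x\<bar> < d x" "\<bar>v - x\<bar> < d x" by (auto simp: dist_real_def)
        then have "norm (g u - g x - (u - x) *\<^sub>R h x) \<le> e1 * (x - u)"
          "norm (g v - g x - (v - x) *\<^sub>R h x) \<le> e1 * (v - x)"
          using d(2)[of x u] d(2)[of x v] uv \<open>x \<notin> N\<close> by auto
        then have "norm ((g u - g x - (u - x) *\<^sub>R h x) - (g v - g x - (v - x) *\<^sub>R h x)) \<le> e1 * (x - u) + e1 * (v - x)"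
          by (metis add_mono norm_triangle_ineq4 order_trans)
        moreover have "(g u - g x - (u - x) *\<^sub>R h x) - (g v - g x - (v - x) *\<^sub>R h x)
            = measure lborel K *\<^sub>R h0 x - (g (Sup K) - g (Inf K))"
          using uv \<open>x \<notin> N\<close> by (simp add: h0_def algebra_simps)
        moreover have "e1 * (x - u) + e1 * (v - x) = e1 * measure lborel K"
          using uv by (simp add: algebra_simps)
        ultimately show ?thesis by simp
      qed
      \<comment> \<open>The increments of g over a division telescope, which distributes
        \<open>g b - g a\<close> over the intervals.\<close>
      have "(\<Sum>(x, K)\<in>p. measure lborel K *\<^sub>R h0 x) - (g b - g a)
          = (\<Sum>(x, K)\<in>p. measure lborel K *\<^sub>R h0 x - (g (Sup K) - g (Inf K)))"
        using additive_tagged_division_1[OF \<open>a \<le> b\<close> p, of g]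
        by (simp add: case_prod_beta sum_subtractf)
      also have "norm \<dots> \<le> (\<Sum>(x, K)\<in>p. norm (measure lborel K *\<^sub>R h0 x - (g (Sup K) - g (Inf K))))"
        unfolding case_prod_beta by (rule norm_sum)
      also have "\<dots> = (\<Sum>(x, K)\<in>p1. norm (measure lborel K *\<^sub>R h0 x - (g (Sup K) - g (Inf K))))
          + (\<Sum>(x, K)\<in>p2. norm (measure lborel K *\<^sub>R h0 x - (g (Sup K) - g (Inf K))))"
        unfolding p12(1) by (rule sum.union_disjoint) (use p12 in auto)
      also have "(\<Sum>(x, K)\<in>p1. norm (measure lborel K *\<^sub>R h0 x - (g (Sup K) - g (Inf K))))
          = (\<Sum>(x, K)\<in>p1. norm (g (Sup K) - g (Inf K)))"
        by (intro sum.cong) (auto simp: p1_def h0_def norm_minus_commute)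
      also have "(\<Sum>(x, K)\<in>p2. norm (measure lborel K *\<^sub>R h0 x - (g (Sup K) - g (Inf K))))
          \<le> (\<Sum>(x, K)\<in>p2. e1 * measure lborel K)"
        using p2_le by (intro sum_mono) auto
      also have "\<dots> \<le> (\<Sum>(x, K)\<in>p. e1 * measure lborel K)"
        using p12 e1 pD(1) by (intro sum_mono2) auto
      also have "\<dots> = e1 * (b - a)"
        using additive_content_tagged_division[of p a b] p \<open>a \<le> b\<close>
        by (simp add: case_prod_beta sum_distrib_left[symmetric])
      finally show ?thesis using p1_less e1(2) by linarith
    qed
    show "\<exists>\<gamma>. gauge \<gamma> \<and> (\<forall>p. p tagged_division_of {a..b} \<and> \<gamma> fine p \<longrightarrow>
        norm ((\<Sum>(x, K)\<in>p. measure lborel K *\<^sub>R h0 x) - (g b - g a)) < e)"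
      by (intro exI[of _ \<gamma>] conjI allI impI gauge) (elim conjE, rule bound)
  qed
  then show ?thesis
    by (rule has_integral_spike[rotated 2]) (use N in \<open>auto simp: h0_def negligible_iff_null_sets\<close>)
qed

lemma abs_cont_on_imp_continuous_on:
  fixes g :: "real \<Rightarrow> 'a::real_normed_vector"
  assumes "abs_cont_on a b g"
  shows "continuous_on {a..b} g"
  unfolding continuous_on_iff
proof (intro ballI allI impI)
  fix x e :: real assume x: "x \<in> {a..b}" and "e > 0"
  from assms[unfolded abs_cont_on_def, rule_format, OF \<open>e > 0\<close>]
  obtain \<delta> where "\<delta> > 0" and \<delta>: "\<forall>I :: (real \<times> real) set.
        finite I \<and> (\<forall>(u, v)\<in>I. a \<le> u \<and> u \<le> v \<and> v \<le> b) \<and>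
        pairwise (\<lambda>(u, v) (u', v'). {u<..<v} \<inter> {u'<..<v'} = {}) I \<and>
        (\<Sum>(u, v)\<in>I. v - u) < \<delta> \<longrightarrow> (\<Sum>(u, v)\<in>I. norm (g v - g u)) < e"
    by (elim exE conjE)
  have "dist (g y) (g x) < e" if "y \<in> {a..b}" "dist y x < \<delta>" for y
    using \<delta>[rule_format, of "{(x, y)}"] \<delta>[rule_format, of "{(y, x)}"] that x
    by (cases "x \<le> y") (auto simp: dist_norm norm_minus_commute)
  then show "\<exists>d>0. \<forall>y\<in>{a..b}. dist y x < d \<longrightarrow> dist (g y) (g x) < e"
    using \<open>\<delta> > 0\<close> by blast
qed

section \<open>The Krasovskii functional\<close>

lemma antiderivative_atLeast:
  fixes h :: "real \<Rightarrow> 'a::banach"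
  assumes "continuous_on {a..} h" "s \<ge> a"
  shows "((\<lambda>s. integral {a..s} h) has_vector_derivative h s) (at s within {a..})"
proof -
  \<comment> \<open>The bound s + 1 leaves room to the right of s, so both intervals give the same
    filter at s.\<close>
  have "((\<lambda>s. integral {a..s} h) has_vector_derivative h s) (at s within {a..s + 1})"
    by (rule integral_has_vector_derivative) (use assms in \<open>auto intro: continuous_on_subset\<close>)
  moreover have "at s within {a..s + 1} = at s within {a..}"
    by (rule at_within_nhd[of s "{..<s + 1}"]) auto
  ultimately show ?thesis by simp
qed

text \<open>Integration by parts moves the \<open>t\<close>-derivative from the merely continuous \<open>h\<close> to its
  antiderivative.\<close>

lemma moving_integral_has_vector_derivative:
  fixes prod :: "'a::real_normed_vector \<Rightarrow> 'b::banach \<Rightarrow> 'c::banach"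
  assumes bil: "bounded_bilinear prod"
    and "r \<ge> 0" and "t \<ge> t0"
    and F: "\<And>\<tau>. \<tau> \<in> {-r..0} \<Longrightarrow> (F has_vector_derivative F' \<tau>) (at \<tau> within {-r..0})"
    and F': "continuous_on {-r..0} F'" and h: "continuous_on {t0 - r..} h"
  shows "((\<lambda>t. integral {-r..0} (\<lambda>\<tau>. prod (F \<tau>) (h (t + \<tau>)))) has_vector_derivative
    (prod (F 0) (h t) - prod (F (-r)) (h (t - r)) - integral {-r..0} (\<lambda>\<tau>. prod (F' \<tau>) (h (t + \<tau>)))))
    (at t within {t0..})"
proof -
  interpret bounded_bilinear prod by (fact bil)
  \<comment> \<open>The base point t0 - r is the least value of t + \<tau> for t \<ge> t0.\<close>
  define H where "H s = integral {t0 - r..s} h" for s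
  have H: "(H has_vector_derivative h s) (at s within {t0 - r..})" if "s \<ge> t0 - r" for s
    unfolding H_def by (rule antiderivative_atLeast[OF h that])
  have H_shift: "((\<lambda>x. H (x + c)) has_vector_derivative h (x + c)) (at x within A)"
    if "x \<in> A" "\<And>y. y \<in> A \<Longrightarrow> y + c \<ge> t0 - r" for x c and A :: "real set"
    using vector_diff_chain_within[of "\<lambda>x. x + c" 1 x A H "h (x + c)"]
      has_vector_derivative_within_subset[OF H[OF that(2)[OF that(1)]], of "(\<lambda>x. x + c) ` A"] that(2)
    by (force intro!: derivative_eq_intros simp: comp_def)
  have contF: "continuous_on {-r..0} F"
    using F by (rule continuous_on_vector_derivative)
  have contH: "continuous_on {t0 - r..} H"
    using H by (intro continuous_on_vector_derivative) auto
  have [continuous_intros]: "continuous_on {-r..0} (\<lambda>\<tau>. h (t + \<tau>))" "continuous_on {-r..0} (\<lambda>\<tau>. H (t + \<tau>))"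
    if "t \<ge> t0" for t
    using that by (auto intro!: continuous_on_compose2[OF h] continuous_on_compose2[OF contH] continuous_intros)
  have parts: "integral {-r..0} (\<lambda>\<tau>. prod (F \<tau>) (h (t + \<tau>)))
      = prod (F 0) (H (t + 0)) - prod (F (-r)) (H (t + - r)) - integral {-r..0} (\<lambda>\<tau>. prod (F' \<tau>) (H (t + \<tau>)))"
    if "t \<ge> t0" for t
  proof -
    have ftc: "((\<lambda>\<tau>. prod (F \<tau>) (h (t + \<tau>)) + prod (F' \<tau>) (H (t + \<tau>))) has_integral
        (prod (F 0) (H (t + 0)) - prod (F (-r)) (H (t + - r)))) {-r..0}"
    proof (rule fundamental_theorem_of_calculus)
      fix \<tau> assume \<tau>: "\<tau> \<in> {-r..0}"
      have "((\<lambda>\<tau>. H (t + \<tau>)) has_vector_derivative h (t + \<tau>)) (at \<tau> within {-r..0})"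
        using H_shift[of \<tau> "{-r..0}" t] \<tau> that by (simp add: add.commute)
      with F[OF \<tau>] show "((\<lambda>\<tau>. prod (F \<tau>) (H (t + \<tau>))) has_vector_derivative
          prod (F \<tau>) (h (t + \<tau>)) + prod (F' \<tau>) (H (t + \<tau>))) (at \<tau> within {-r..0})"
        by (rule has_vector_derivative)
    qed (use \<open>r \<ge> 0\<close> in simp)
    have int: "(\<lambda>\<tau>. prod (F \<tau>) (h (t + \<tau>))) integrable_on {-r..0}"
      "(\<lambda>\<tau>. prod (F' \<tau>) (H (t + \<tau>))) integrable_on {-r..0}"
      by (intro integrable_continuous_interval continuous_on continuous_intros contF F' that)+
    show ?thesis
      using integral_unique[OF ftc] Henstock_Kurzweil_Integration.integral_add[OF int] by (simp add: eq_diff_eq)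
  qed
  \<comment> \<open>Differentiation under the integral requires joint continuity only of the partial
    derivative in t, and this involves h but not a derivative of h.\<close>
  have "((\<lambda>t. integral (cbox (-r) 0) (\<lambda>\<tau>. prod (F' \<tau>) (H (t + \<tau>)))) has_vector_derivative
      integral (cbox (-r) 0) (\<lambda>\<tau>. prod (F' \<tau>) (h (t + \<tau>)))) (at t within {t0..})"
  proof (rule leibniz_rule_vector_derivative)
    show "((\<lambda>x. prod (F' \<tau>) (H (x + \<tau>))) has_vector_derivative prod (F' \<tau>) (h (x + \<tau>))) (at x within {t0..})"
      if "x \<in> {t0..}" "\<tau> \<in> cbox (-r) 0" for x \<tau>
      using H_shift[of x "{t0..}" \<tau>] that
      by (intro bounded_linear.has_vector_derivative[OF bounded_linear_right]) auto
    show "(\<lambda>\<tau>. prod (F' \<tau>) (H (x + \<tau>))) integrable_on cbox (-r) 0" if "x \<in> {t0..}" for x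
      unfolding cbox_interval
      by (intro integrable_continuous_interval continuous_on continuous_intros F') (use that in simp)
    show "continuous_on ({t0..} \<times> cbox (-r) 0) (\<lambda>(x, \<tau>). prod (F' \<tau>) (h (x + \<tau>)))"
      unfolding split_beta
      by (intro continuous_on continuous_on_compose2[OF F'] continuous_on_compose2[OF h] continuous_intros) auto
  qed (use \<open>t \<ge> t0\<close> in auto)
  then have "((\<lambda>t. prod (F 0) (H (t + 0)) - prod (F (-r)) (H (t + - r)) - integral {-r..0} (\<lambda>\<tau>. prod (F' \<tau>) (H (t + \<tau>))))
    has_vector_derivative (prod (F 0) (h (t + 0)) - prod (F (-r)) (h (t + - r)) - integral {-r..0} (\<lambda>\<tau>. prod (F' \<tau>) (h (t + \<tau>)))))
    (at t within {t0..})"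
    unfolding cbox_interval using \<open>t \<ge> t0\<close> \<open>r \<ge> 0\<close>
    by (intro has_vector_derivative_diff bounded_linear.has_vector_derivative[OF bounded_linear_right] H_shift) auto
  then have "((\<lambda>t. integral {-r..0} (\<lambda>\<tau>. prod (F \<tau>) (h (t + \<tau>)))) has_vector_derivative
    (prod (F 0) (h (t + 0)) - prod (F (-r)) (h (t + - r)) - integral {-r..0} (\<lambda>\<tau>. prod (F' \<tau>) (h (t + \<tau>)))))
    (at t within {t0..})"
    by (rule has_vector_derivative_transform[rotated 2]) (use \<open>t \<ge> t0\<close> in \<open>auto simp: parts\<close>)
  then show ?thesis by simp
qed

text \<open>The residual e of the projection of \<phi> onto the span of the components of g has a
  nonnegative W-form. Orthonormality turns the integral of that form into the right-hand side minus
  the left-hand side.\<close>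

lemma orthonormal_bessel:
  fixes g :: "real \<Rightarrow> real^'d" and \<phi> :: "real \<Rightarrow> real^'k"
  assumes g: "continuous_on {a..b} g" and \<phi>: "continuous_on {a..b} \<phi>"
    and orth: "\<And>i j. ((\<lambda>\<tau>. g \<tau> $ i * g \<tau> $ j) has_integral (if i = j then 1 else 0)) {a..b}"
    and W: "sym_mat W" "\<And>v. v \<bullet> (W *v v) \<ge> 0"
  shows "(\<Sum>i\<in>UNIV. integral {a..b} (\<lambda>\<tau>. g \<tau> $ i *\<^sub>R \<phi> \<tau>) \<bullet> (W *v integral {a..b} (\<lambda>\<tau>. g \<tau> $ i *\<^sub>R \<phi> \<tau>)))
    \<le> integral {a..b} (\<lambda>\<tau>. \<phi> \<tau> \<bullet> (W *v \<phi> \<tau>))"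
proof -
  define y where "y i = integral {a..b} (\<lambda>\<tau>. g \<tau> $ i *\<^sub>R \<phi> \<tau>)" for i
  have y: "((\<lambda>\<tau>. g \<tau> $ i *\<^sub>R \<phi> \<tau>) has_integral y i) {a..b}" for i
    unfolding y_def using g \<phi>
    by (intro integrable_integral integrable_continuous_interval continuous_intros)
  define e where "e \<tau> = \<phi> \<tau> - (\<Sum>i\<in>UNIV. g \<tau> $ i *\<^sub>R y i)" for \<tau>
  note sym = sym_mat_inner_commute[OF W(1)]
  have e_form: "e \<tau> \<bullet> (W *v e \<tau>) = \<phi> \<tau> \<bullet> (W *v \<phi> \<tau>) - 2 * (\<Sum>i\<in>UNIV. (g \<tau> $ i *\<^sub>R \<phi> \<tau>) \<bullet> (W *v y i))
      + (\<Sum>i\<in>UNIV. \<Sum>j\<in>UNIV. (g \<tau> $ i * g \<tau> $ j) * (y i \<bullet> (W *v y j)))" for \<tau>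
  proof -
    let ?s = "\<Sum>i\<in>UNIV. g \<tau> $ i *\<^sub>R y i"
    have lin: "W *v ?s = (\<Sum>i\<in>UNIV. g \<tau> $ i *\<^sub>R (W *v y i))"
      by (simp add: linear_sum[OF matrix_vector_mul_linear] matrix_vector_mult_scaleR)
    have "e \<tau> \<bullet> (W *v e \<tau>) = \<phi> \<tau> \<bullet> (W *v \<phi> \<tau>) - 2 * (\<phi> \<tau> \<bullet> (W *v ?s)) + ?s \<bullet> (W *v ?s)"
      using sym[of ?s "\<phi> \<tau>"] by (simp add: e_def matrix_vector_mult_diff_distrib inner_diff_left inner_diff_right)
    also have "\<phi> \<tau> \<bullet> (W *v ?s) = (\<Sum>i\<in>UNIV. (g \<tau> $ i *\<^sub>R \<phi> \<tau>) \<bullet> (W *v y i))"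
      by (simp add: lin inner_sum_right)
    also have "?s \<bullet> (W *v ?s) = (\<Sum>i\<in>UNIV. \<Sum>j\<in>UNIV. (g \<tau> $ i * g \<tau> $ j) * (y i \<bullet> (W *v y j)))"
      by (simp add: lin inner_sum_left inner_sum_right mult.assoc sum_distrib_left sym)
    finally show ?thesis .
  qed
  have "((\<lambda>\<tau>. e \<tau> \<bullet> (W *v e \<tau>)) has_integral
      (integral {a..b} (\<lambda>\<tau>. \<phi> \<tau> \<bullet> (W *v \<phi> \<tau>)) - 2 * (\<Sum>i\<in>UNIV. y i \<bullet> (W *v y i))
       + (\<Sum>i\<in>UNIV. \<Sum>j\<in>UNIV. (if i = j then 1 else 0) * (y i \<bullet> (W *v y j))))) {a..b}"
    unfolding e_form
  proof (intro has_integral_add has_integral_diff has_integral_mult_right has_integral_sum has_integral_mult_left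
      finite_class.finite_UNIV orth)
    show "((\<lambda>\<tau>. \<phi> \<tau> \<bullet> (W *v \<phi> \<tau>)) has_integral integral {a..b} (\<lambda>\<tau>. \<phi> \<tau> \<bullet> (W *v \<phi> \<tau>))) {a..b}"
      by (intro integrable_integral integrable_continuous_interval continuous_on_inner \<phi>
          linear_continuous_on_compose[OF \<phi> matrix_vector_mul_linear])
    show "((\<lambda>\<tau>. (g \<tau> $ i *\<^sub>R \<phi> \<tau>) \<bullet> (W *v y i)) has_integral y i \<bullet> (W *v y i)) {a..b}" for i
      using has_integral_linear[OF y bounded_linear_inner_left] by (simp add: comp_def)
  qed
  \<comment> \<open>Only the diagonal survives, so the quadratic term cancels one of the two copies
    in the mixed term.\<close>
  also have "(\<Sum>i\<in>UNIV. \<Sum>j\<in>UNIV. (if i = j then 1 else 0) * (y i \<bullet> (W *v y j))) = (\<Sum>i\<in>UNIV. y i \<bullet> (W *v y i))"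
  proof (intro sum.cong refl)
    fix i :: 'd
    have "(\<Sum>j\<in>UNIV. (if i = j then 1 else 0) * (y i \<bullet> (W *v y j))) = (\<Sum>j\<in>UNIV. if j = i then y i \<bullet> (W *v y j) else 0)"
      by (intro sum.cong) auto
    then show "(\<Sum>j\<in>UNIV. (if i = j then 1 else 0) * (y i \<bullet> (W *v y j))) = y i \<bullet> (W *v y i)"
      by simp
  qed
  finally have "0 \<le> integral {a..b} (\<lambda>\<tau>. \<phi> \<tau> \<bullet> (W *v \<phi> \<tau>)) - 2 * (\<Sum>i\<in>UNIV. y i \<bullet> (W *v y i))
       + (\<Sum>i\<in>UNIV. y i \<bullet> (W *v y i))"
    by (rule has_integral_nonneg) (rule W)
  then show ?thesis by (simp add: y_def)
qed

text \<open>The weight \<tau> + r is what remains of the usual double integral of the U-form over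
  \<theta> \<le> s \<le> 0 and -r \<le> \<theta> \<le> 0 after exchanging the order of integration.
  It vanishes at -r and has slope 1, so along a trajectory it yields r times the U-form at time t,
  nothing at t - r, and minus the integral of the U-form.\<close>

definition krasovskii ::
  "real \<Rightarrow> (real \<Rightarrow> real^'k^'l) \<Rightarrow> real^'k^'k \<Rightarrow> real^'l^'k \<Rightarrow> real^'l^'l \<Rightarrow> real^'k^'k \<Rightarrow> real^'k^'k \<Rightarrow>
   (real \<Rightarrow> real^'k) \<Rightarrow> real" where
  "krasovskii r F P Q R S U \<phi> =
    (let y = integral {-r..0} (\<lambda>\<tau>. F \<tau> *v \<phi> \<tau>) in
      \<phi> 0 \<bullet> (P *v \<phi> 0) + 2 * (\<phi> 0 \<bullet> (Q *v y)) + y \<bullet> (R *v y)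
      + integral {-r..0} (\<lambda>\<tau>. \<phi> \<tau> \<bullet> ((S + (\<tau> + r) *\<^sub>R U) *v \<phi> \<tau>)))"

text \<open>Bridges the extensional functions produced by \<open>segment_at\<close> and plain shifts
  of the trajectory.\<close>

lemma krasovskii_cong:
  assumes "r \<ge> 0" "\<And>\<tau>. \<tau> \<in> {-r..0} \<Longrightarrow> \<phi> \<tau> = \<psi> \<tau>"
  shows "krasovskii r F P Q R S U \<phi> = krasovskii r F P Q R S U \<psi>"
proof -
  have "integral {-r..0} (\<lambda>\<tau>. F \<tau> *v \<phi> \<tau>) = integral {-r..0} (\<lambda>\<tau>. F \<tau> *v \<psi> \<tau>)"
    "integral {-r..0} (\<lambda>\<tau>. \<phi> \<tau> \<bullet> ((S + (\<tau> + r) *\<^sub>R U) *v \<phi> \<tau>)) =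
     integral {-r..0} (\<lambda>\<tau>. \<psi> \<tau> \<bullet> ((S + (\<tau> + r) *\<^sub>R U) *v \<psi> \<tau>))"
    using assms by (auto intro!: integral_cong)
  moreover have "\<phi> 0 = \<psi> 0" using assms by simp
  ultimately show ?thesis by (simp add: krasovskii_def)
qed

lemma tendsto_integral_uniform:
  fixes f :: "'i \<Rightarrow> real \<Rightarrow> 'c::banach"
  assumes "uniform_limit {a..b} f g F" "\<And>n. continuous_on {a..b} (f n)" "F \<noteq> bot"
  shows "((\<lambda>n. integral {a..b} (f n)) \<longlongrightarrow> integral {a..b} g) F"
proof -
  obtain I J where IJ: "\<And>n. (f n has_integral I n) {a..b}" "(g has_integral J) {a..b}" "(I \<longlongrightarrow> J) F"
    using uniform_limit_integral[OF assms] by blast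
  have "I = (\<lambda>n. integral {a..b} (f n))" "J = integral {a..b} g"
    using IJ(1,2) by (simp_all add: fun_eq_iff integral_unique[symmetric])
  with IJ(3) show ?thesis by simp
qed

text \<open>Convergence in the sup metric is uniform convergence on [-r, 0], which passes through
  evaluation at 0 and through both integrals.\<close>

lemma continuous_map_krasovskii:
  assumes "r \<ge> 0" and F: "continuous_on {-r..0} F"
  shows "continuous_map (mtopology_of (cfunspace (top_of_set {-r..0}) euclidean_metric)) euclidean
    (krasovskii r F P Q R S U)"
  unfolding continuous_map_atin limitin_canonical_iff
proof
  let ?m = "cfunspace (top_of_set {-r..0}) euclidean_metric :: (real \<Rightarrow> real^'a) metric"
  fix \<phi> assume "\<phi> \<in> topspace (mtopology_of ?m)"
  then have \<phi>: "\<phi> \<in> mspace ?m" by (simp only: topspace_mtopology_of)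
  let ?F = "atin (mtopology_of ?m) \<phi>"
  show "(krasovskii r F P Q R S U \<longlongrightarrow> krasovskii r F P Q R S U \<phi>) ?F"
  proof (cases "?F = bot")
    \<comment> \<open>Passing limits through an integral requires a proper filter; along the trivial
      filter every limit statement holds.\<close>
    case False
    have ev: "\<forall>\<^sub>F \<psi> in ?F. \<psi> \<in> mspace ?m \<and> mdist ?m \<psi> \<phi> < e" if "e > 0" for e
      unfolding mtopology_of_def Metric_space.eventually_atin_metric[OF Metric_space_mspace_mdist]
      using that by blast
    \<comment> \<open>Points outside the function space are replaced by \<phi>, so continuity holds
      for every argument and not just eventually. Along the filter \<open>tr\<close> is eventually
      the identity.\<close>
    define tr where "tr \<psi> = (if \<psi> \<in> mspace ?m then \<psi> else \<phi>)" for \<psi>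
    have tr_mem: "tr \<psi> \<in> mspace ?m" for \<psi>
      using \<phi> by (simp only: tr_def split: if_split) blast
    have cont: "continuous_on {-r..0} \<psi>" if "\<psi> \<in> mspace ?m" for \<psi>
      using that by simp
    note cont_tr = cont[OF tr_mem] and cont_\<phi> = cont[OF \<phi>]
    have tr_lim: "uniform_limit {-r..0} tr \<phi> ?F"
    proof (rule uniform_limitI)
      fix e :: real assume "e > 0"
      show "\<forall>\<^sub>F \<psi> in ?F. \<forall>\<tau>\<in>{-r..0}. dist (tr \<psi> \<tau>) (\<phi> \<tau>) < e"
        using ev[OF \<open>e > 0\<close>]
      proof eventually_elim
        case (elim \<psi>)
        show ?case
        proof
          fix \<tau> assume "\<tau> \<in> {-r..0}"
          then have "mdist euclidean_metric (\<psi> \<tau>) (\<phi> \<tau>) < e"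
            using elim \<phi> by (intro cfunspace_mdist_lt[of "top_of_set {-r..0}" \<psi> euclidean_metric \<phi>]) (auto simp: compactin_subtopology)
          then show "dist (tr \<psi> \<tau>) (\<phi> \<tau>) < e"
            using elim by (simp add: tr_def)
        qed
      qed
    qed
    have bounded: "bounded (h ` {-r..0})" if "continuous_on {-r..0} h" for h :: "real \<Rightarrow> 'c::metric_space"
      using that compact_continuous_image compact_imp_bounded by blast
    have W: "continuous_on {-r..0} (\<lambda>\<tau>. S + (\<tau> + r) *\<^sub>R U)"
      by (intro continuous_intros)
    note mult_cont = bounded_bilinear.continuous_on[OF bounded_bilinear_matrix_vector_mult]
      and mult_lim = bounded_bilinear.bounded_uniform_limit[OF bounded_bilinear_matrix_vector_mult]
      and inner_lim = bounded_bilinear.bounded_uniform_limit[OF bounded_bilinear_inner]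
    have point: "((\<lambda>\<psi>. tr \<psi> 0) \<longlongrightarrow> \<phi> 0) ?F"
      using tr_lim by (rule tendsto_uniform_limitI) (use \<open>r \<ge> 0\<close> in simp)
    have y: "((\<lambda>\<psi>. integral {-r..0} (\<lambda>\<tau>. F \<tau> *v tr \<psi> \<tau>)) \<longlongrightarrow> integral {-r..0} (\<lambda>\<tau>. F \<tau> *v \<phi> \<tau>)) ?F"
      by (intro tendsto_integral_uniform mult_lim uniform_limit_const tr_lim bounded mult_cont F cont_tr cont_\<phi> False)
    have q: "((\<lambda>\<psi>. integral {-r..0} (\<lambda>\<tau>. tr \<psi> \<tau> \<bullet> ((S + (\<tau> + r) *\<^sub>R U) *v tr \<psi> \<tau>))) \<longlongrightarrow>
        integral {-r..0} (\<lambda>\<tau>. \<phi> \<tau> \<bullet> ((S + (\<tau> + r) *\<^sub>R U) *v \<phi> \<tau>))) ?F"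
      by (intro tendsto_integral_uniform inner_lim mult_lim uniform_limit_const tr_lim bounded
          continuous_on_inner mult_cont W cont_tr cont_\<phi> False)
    have "((\<lambda>\<psi>. krasovskii r F P Q R S U (tr \<psi>)) \<longlongrightarrow> krasovskii r F P Q R S U \<phi>) ?F"
      unfolding krasovskii_def Let_def
      by (intro tendsto_intros y q point bounded_linear.tendsto[OF matrix_vector_mul_bounded_linear])
    moreover have "\<forall>\<^sub>F \<psi> in ?F. krasovskii r F P Q R S U (tr \<psi>) = krasovskii r F P Q R S U \<psi>"
      using ev[of 1] by (simp add: tr_def eventually_mono)
    ultimately show ?thesis by (simp add: tendsto_cong)
  qed simp
qed

text \<open>The quadratic part needs only the product rule for x and the kernel integral, where
  symmetry of P and R merges mirrored terms into the factor 2. The S and U parts are moving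
  integrals with scalar weights 1 and \<tau> + r.\<close>

lemma krasovskii_segment_has_derivative:
  fixes x :: "real \<Rightarrow> real^'k" and F :: "real \<Rightarrow> real^'k^'l"
  assumes "r \<ge> 0" "t \<ge> t0" and "sym_mat P" "sym_mat R"
    and F: "\<And>\<tau>. \<tau> \<in> {-r..0} \<Longrightarrow> (F has_vector_derivative N ** F \<tau>) (at \<tau> within {-r..0})"
    and x: "continuous_on {t0 - r..} x" and x': "(x has_vector_derivative x') (at t within {t0..})"
  defines "y \<equiv> integral {-r..0} (\<lambda>\<tau>. F \<tau> *v x (t + \<tau>))"
  defines "y' \<equiv> F 0 *v x t - F (-r) *v x (t - r) - N *v y"
  shows "((\<lambda>t. krasovskii r F P Q R S U (segment_at r x t)) has_real_derivative
    2 * ((P *v x t + Q *v y) \<bullet> x' + x t \<bullet> (Q *v y') + y \<bullet> (R *v y'))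
    + x t \<bullet> ((S + r *\<^sub>R U) *v x t) - x (t - r) \<bullet> (S *v x (t - r))
    - integral {-r..0} (\<lambda>\<tau>. x (t + \<tau>) \<bullet> (U *v x (t + \<tau>)))) (at t within {t0..})"
proof -
  define Y where "Y s = integral {-r..0} (\<lambda>\<tau>. F \<tau> *v x (s + \<tau>))" for s
  have contF: "continuous_on {-r..0} F"
    using F by (rule continuous_on_vector_derivative)
  have contNF: "continuous_on {-r..0} (\<lambda>\<tau>. N ** F \<tau>)"
    using contF unfolding matrix_matrix_mult_def by (intro continuous_intros)
  have cont_shift: "continuous_on {-r..0} (\<lambda>\<tau>. x (s + \<tau>))" if "s \<ge> t0" for s
    using that by (auto intro!: continuous_on_compose2[OF x] continuous_intros)
  note mult_cont = bounded_bilinear.continuous_on[OF bounded_bilinear_matrix_vector_mult]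
  \<comment> \<open>The differential equation for F closes the system: its derivative integrated
    against the history is N applied to y again.\<close>
  have "integral {-r..0} (\<lambda>\<tau>. (N ** F \<tau>) *v x (t + \<tau>)) = N *v y"
  proof -
    have "(\<lambda>\<tau>. F \<tau> *v x (t + \<tau>)) integrable_on {-r..0}"
      by (intro integrable_continuous_interval mult_cont contF cont_shift \<open>t \<ge> t0\<close>)
    from integral_linear[OF this matrix_vector_mul_bounded_linear[of N]] show ?thesis
      by (simp add: comp_def y_def matrix_vector_mul_assoc)
  qed
  with moving_integral_has_vector_derivative[OF bounded_bilinear_matrix_vector_mult \<open>r \<ge> 0\<close> \<open>t \<ge> t0\<close> F contNF x]
  have Y': "(Y has_vector_derivative y') (at t within {t0..})"
    by (simp add: Y_def[abs_def] y'_def)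
  have cont_form: "continuous_on {t0 - r..} (\<lambda>s. x s \<bullet> (W *v x s))" for W
    by (intro continuous_on_inner mult_cont continuous_intros x)
  have S': "((\<lambda>s. integral {-r..0} (\<lambda>\<tau>. 1 * (x (s + \<tau>) \<bullet> (S *v x (s + \<tau>))))) has_vector_derivative
      (1 * (x t \<bullet> (S *v x t)) - 1 * (x (t - r) \<bullet> (S *v x (t - r)))
       - integral {-r..0} (\<lambda>\<tau>. 0 * (x (t + \<tau>) \<bullet> (S *v x (t + \<tau>)))))) (at t within {t0..})"
    by (rule moving_integral_has_vector_derivative[OF bounded_bilinear_mult \<open>r \<ge> 0\<close> \<open>t \<ge> t0\<close> _ _ cont_form])
      (auto intro!: derivative_eq_intros continuous_intros)
  have U': "((\<lambda>s. integral {-r..0} (\<lambda>\<tau>. (\<tau> + r) * (x (s + \<tau>) \<bullet> (U *v x (s + \<tau>))))) has_vector_derivative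
      ((0 + r) * (x t \<bullet> (U *v x t)) - (- r + r) * (x (t - r) \<bullet> (U *v x (t - r)))
       - integral {-r..0} (\<lambda>\<tau>. 1 * (x (t + \<tau>) \<bullet> (U *v x (t + \<tau>)))))) (at t within {t0..})"
    by (rule moving_integral_has_vector_derivative[OF bounded_bilinear_mult \<open>r \<ge> 0\<close> \<open>t \<ge> t0\<close> _ _ cont_form])
      (auto intro!: derivative_eq_intros continuous_intros)
  have split: "krasovskii r F P Q R S U (segment_at r x s) =
      x s \<bullet> (P *v x s) + 2 * (x s \<bullet> (Q *v Y s)) + Y s \<bullet> (R *v Y s)
      + (integral {-r..0} (\<lambda>\<tau>. 1 * (x (s + \<tau>) \<bullet> (S *v x (s + \<tau>))))
      + integral {-r..0} (\<lambda>\<tau>. (\<tau> + r) * (x (s + \<tau>) \<bullet> (U *v x (s + \<tau>)))))" if "s \<ge> t0" for s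
  proof -
    have "krasovskii r F P Q R S U (segment_at r x s) = krasovskii r F P Q R S U (\<lambda>\<tau>. x (s + \<tau>))"
      using \<open>r \<ge> 0\<close> by (intro krasovskii_cong) (auto simp: segment_at_def)
    moreover have "integral {-r..0} (\<lambda>\<tau>. x (s + \<tau>) \<bullet> ((S + (\<tau> + r) *\<^sub>R U) *v x (s + \<tau>)))
      = integral {-r..0} (\<lambda>\<tau>. 1 * (x (s + \<tau>) \<bullet> (S *v x (s + \<tau>))) + (\<tau> + r) * (x (s + \<tau>) \<bullet> (U *v x (s + \<tau>))))"
      by (simp add: matrix_vector_mult_add_rdistrib inner_add_right)
    moreover have "\<dots> = integral {-r..0} (\<lambda>\<tau>. 1 * (x (s + \<tau>) \<bullet> (S *v x (s + \<tau>))))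
      + integral {-r..0} (\<lambda>\<tau>. (\<tau> + r) * (x (s + \<tau>) \<bullet> (U *v x (s + \<tau>))))"
      by (intro Henstock_Kurzweil_Integration.integral_add integrable_continuous_interval continuous_on_mult
          continuous_on_inner mult_cont continuous_on_const cont_shift that continuous_intros)
    ultimately show ?thesis by (simp add: krasovskii_def Y_def Let_def)
  qed
  have mult_deriv: "((\<lambda>s. W *v z s) has_vector_derivative W *v z') (at t within {t0..})"
    if "(z has_vector_derivative z') (at t within {t0..})" for z z' and W :: "real^'i^'j"
    using that by (rule bounded_linear.has_vector_derivative[OF matrix_vector_mul_bounded_linear])
  have inner_deriv: "((\<lambda>s. u s \<bullet> z s) has_vector_derivative u t \<bullet> z' + u' \<bullet> z t) (at t within {t0..})"
    if "(u has_vector_derivative u') (at t within {t0..})" "(z has_vector_derivative z') (at t within {t0..})"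
    for u z :: "real \<Rightarrow> real^'i" and u' z'
    using that by (rule bounded_bilinear.has_vector_derivative[OF bounded_bilinear_inner])
  have "((\<lambda>s. x s \<bullet> (P *v x s) + 2 * (x s \<bullet> (Q *v Y s)) + Y s \<bullet> (R *v Y s)
      + (integral {-r..0} (\<lambda>\<tau>. 1 * (x (s + \<tau>) \<bullet> (S *v x (s + \<tau>))))
      + integral {-r..0} (\<lambda>\<tau>. (\<tau> + r) * (x (s + \<tau>) \<bullet> (U *v x (s + \<tau>))))))
    has_vector_derivative
      (x t \<bullet> (P *v x') + x' \<bullet> (P *v x t)) + 2 * (x t \<bullet> (Q *v y') + x' \<bullet> (Q *v Y t)) + (Y t \<bullet> (R *v y') + y' \<bullet> (R *v Y t))
      + ((1 * (x t \<bullet> (S *v x t)) - 1 * (x (t - r) \<bullet> (S *v x (t - r)))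
       - integral {-r..0} (\<lambda>\<tau>. 0 * (x (t + \<tau>) \<bullet> (S *v x (t + \<tau>)))))
      + ((0 + r) * (x t \<bullet> (U *v x t)) - (- r + r) * (x (t - r) \<bullet> (U *v x (t - r)))
       - integral {-r..0} (\<lambda>\<tau>. 1 * (x (t + \<tau>) \<bullet> (U *v x (t + \<tau>))))))) (at t within {t0..})"
    by (intro has_vector_derivative_add inner_deriv mult_deriv x' Y' S' U'
        bounded_linear.has_vector_derivative[OF bounded_linear_mult_right])
  then have "((\<lambda>s. krasovskii r F P Q R S U (segment_at r x s)) has_vector_derivative
      (x t \<bullet> (P *v x') + x' \<bullet> (P *v x t)) + 2 * (x t \<bullet> (Q *v y') + x' \<bullet> (Q *v Y t)) + (Y t \<bullet> (R *v y') + y' \<bullet> (R *v Y t))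
      + ((1 * (x t \<bullet> (S *v x t)) - 1 * (x (t - r) \<bullet> (S *v x (t - r)))
       - integral {-r..0} (\<lambda>\<tau>. 0 * (x (t + \<tau>) \<bullet> (S *v x (t + \<tau>)))))
      + ((0 + r) * (x t \<bullet> (U *v x t)) - (- r + r) * (x (t - r) \<bullet> (U *v x (t - r)))
       - integral {-r..0} (\<lambda>\<tau>. 1 * (x (t + \<tau>) \<bullet> (U *v x (t + \<tau>))))))) (at t within {t0..})"
    by (rule has_vector_derivative_transform[rotated 2]) (use \<open>t \<ge> t0\<close> split in auto)
  moreover have "x t \<bullet> (P *v x') = x' \<bullet> (P *v x t)" "y' \<bullet> (R *v Y t) = Y t \<bullet> (R *v y')"
    by (intro sym_mat_inner_commute assms)+
  moreover have "Y t = y" by (simp add: Y_def y_def)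
  ultimately show ?thesis
    unfolding has_real_derivative_iff_has_vector_derivative
    by (simp add: inner_add_left inner_add_right inner_commute[of x']
        matrix_vector_mult_add_rdistrib algebra_simps)
qed

section \<open>Counting the unknowns\<close>

lemma subspace_sym_mat: "subspace {X. sym_mat X}"
  by (auto simp: subspace_def sym_mat_def transpose_def vec_eq_iff)

text \<open>One basis matrix for each unordered pair of indices, encoded as a set with one or two
  elements (the diagonal positions being singletons). Indicator matrices of different pairs have
  disjoint supports, hence are orthogonal.\<close>

lemma dim_sym_mat: "dim {X :: real^'k^'k. sym_mat X} = CARD('k) + (CARD('k) choose 2)"
proof -
  define I where "I = {s :: 'k set. card s = 1} \<union> {s. card s = 2}"
  define E :: "'k set \<Rightarrow> real^'k^'k" where "E s = (\<chi> i j. if {i, j} = s then 1 else 0)" for s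
  have pair: "{i, j} \<in> I" for i j
    by (cases "i = j") (auto simp: I_def)
  have repr: "\<exists>i j. s = {i, j}" if "s \<in> I" for s
    using that by (auto simp: I_def card_1_singleton_iff card_2_iff)
  have orth: "E s \<bullet> E s' = 0" if "s \<noteq> s'" for s s'
    using that by (auto simp: E_def inner_vec_def intro!: sum.neutral split: if_splits)
  have nz: "E s \<noteq> 0" if "s \<in> I" for s
    using repr[OF that] by (auto simp: E_def vec_eq_iff)
  have inj: "inj_on E I"
  proof (rule inj_onI, rule ccontr)
    fix s s' assume "s \<in> I" "E s = E s'" "s \<noteq> s'"
    then show False using orth[of s s'] nz[of s] by simp
  qed
  have "independent (E ` I)"
    using nz
    by (intro pairwise_orthogonal_independent) (auto simp: pairwise_def orthogonal_def intro!: orth)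
  moreover have "E ` I \<subseteq> {X. sym_mat X}"
    by (auto simp: E_def sym_mat_def transpose_def vec_eq_iff insert_commute)
  moreover have "{X. sym_mat X} \<subseteq> span (E ` I)"
  proof clarify
    fix X :: "real^'k^'k" assume "sym_mat X"
    then have sym: "X $ i $ j = X $ j $ i" for i j
      by (simp add: sym_mat_def transpose_def vec_eq_iff)
    \<comment> \<open>The common entry of X at the one or two positions belonging to s; symmetry
      makes it well defined.\<close>
    define c where "c s = (THE a. \<forall>i j. {i, j} = s \<longrightarrow> X $ i $ j = a)" for s
    have c: "c {i, j} = X $ i $ j" for i j
      unfolding c_def by (rule the_equality) (auto simp: doubleton_eq_iff sym)
    have "(\<Sum>s\<in>I. c s *\<^sub>R E s) $ i $ j = (\<Sum>s\<in>I. if s = {i, j} then c s else 0)" for i j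
    proof -
      have "(\<Sum>s\<in>I. c s *\<^sub>R E s) $ i $ j = (\<Sum>s\<in>I. c s * (if {i, j} = s then 1 else 0))"
        by (simp add: E_def)
      also have "\<dots> = (\<Sum>s\<in>I. if s = {i, j} then c s else 0)"
        by (intro sum.cong) auto
      finally show ?thesis .
    qed
    then have "X = (\<Sum>s\<in>I. c s *\<^sub>R E s)"
      using pair by (simp add: vec_eq_iff c)
    then show "X \<in> span (E ` I)"
      by (simp only:) (intro span_sum span_scale span_base imageI)
  qed
  ultimately have "dim {X :: real^'k^'k. sym_mat X} = card (E ` I)"
    by (metis basis_card_eq_dim)
  also have "\<dots> = card I" by (rule card_image[OF inj])
  also have "\<dots> = card {s :: 'k set. card s = 1} + card {s :: 'k set. card s = 2}"
    unfolding I_def by (rule card_Un_disjoint) auto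
  also have "\<dots> = CARD('k) + (CARD('k) choose 2)"
    using n_subsets[of "UNIV :: 'k set" 1] n_subsets[of "UNIV :: 'k set" 2] by simp
  finally show ?thesis .
qed

lemma dim_sym_mat_real: "real (dim {X :: real^'k^'k. sym_mat X}) = real CARD('k) * (real CARD('k) + 1) / 2"
proof -
  have "even (CARD('k) * (CARD('k) - 1))" by simp
  then have "real (CARD('k) choose 2) = real CARD('k) * (real CARD('k) - 1) / 2"
    by (simp add: choose_two real_of_nat_div of_nat_diff Suc_le_eq)
  then show ?thesis by (simp add: dim_sym_mat field_simps)
qed

lemma dim_unknowns_space:
  "real (dim (unknowns_space :: ('k::finite, 'p::finite, 'd::finite) unknowns set)) =
    (0.5 * (real CARD('d))\<^sup>2 + real CARD('d) + 1.5) * (real CARD('k))\<^sup>2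
    + (0.5 * real CARD('d) + real CARD('p) * real CARD('d) + 2 * real CARD('p) + 1.5) * real CARD('k)"
proof -
  have "unknowns_space = {X :: real^'k^'k. sym_mat X} \<times> (UNIV :: (real^('d \<times> 'k)^'k) set)
      \<times> {X :: real^('d \<times> 'k)^('d \<times> 'k). sym_mat X} \<times> {X :: real^'k^'k. sym_mat X} \<times> {X :: real^'k^'k. sym_mat X}
      \<times> (UNIV :: (real^'k^'p) set) \<times> (UNIV :: (real^'k^'p) set) \<times> (UNIV :: (real^('d \<times> 'k)^'p) set)"
    by (auto simp: unknowns_space_def)
  from arg_cong[OF this, of dim] have "real (dim (unknowns_space :: ('k::finite, 'p::finite, 'd::finite) unknowns set)) =
      3 * real (dim {X :: real^'k^'k. sym_mat X}) + real (dim {X :: real^('d \<times> 'k)^('d \<times> 'k). sym_mat X})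
      + real (CARD('k) * (CARD('d) * CARD('k))) + 2 * real (CARD('p) * CARD('k)) + real (CARD('p) * (CARD('d) * CARD('k)))"
    by (simp add: dim_Times subspace_Times subspace_sym_mat subspace_UNIV del: UNIV_Times_UNIV)
  then show ?thesis
    by (simp add: dim_sym_mat_real power2_eq_square field_simps)
qed

lemma unknowns_count_bigo:
  "(\<lambda>(d, n, p). let \<nu> = real n + real p in
      (0.5 * (real d)\<^sup>2 + real d + 1.5) * \<nu>\<^sup>2
      + (0.5 * real d + real p * real d + 2 * real p + 1.5) * \<nu>)
   \<in> O[principal {(d::nat, n::nat, p::nat). d \<ge> 1 \<and> n \<ge> 1 \<and> p \<ge> 1}](
       \<lambda>(d, n, p). (real d)\<^sup>2 * (real n + real p)\<^sup>2)"
proof (rule bigoI[where c = 8], unfold eventually_principal, clarify)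
  fix d n p :: nat assume "d \<ge> 1" "n \<ge> 1" "p \<ge> 1"
  \<comment> \<open>The constant 8 is 3 + 5: with 1 \<le> D \<le> D^2 the first bracket is at most
    (0.5 + 1 + 1.5) D^2, and with P \<le> \<nu> and 1 \<le> \<nu> the second is at most (0.5 + 1 + 2
    + 1.5) D^2 \<nu>.\<close>
  define D \<nu> P where "D = real d" and "\<nu> = real n + real p" and "P = real p"
  have bounds: "D \<ge> 1" "\<nu> \<ge> 1" "P \<ge> 0" "P \<le> \<nu>"
    using \<open>d \<ge> 1\<close> \<open>n \<ge> 1\<close> by (auto simp: D_def \<nu>_def P_def)
  have D2: "D \<le> D\<^sup>2" "1 \<le> D\<^sup>2"
    using bounds mult_mono[of 1 D 1 D] by (auto simp: power2_eq_square)
  have A: "(0.5 * D\<^sup>2 + D + 1.5) * \<nu>\<^sup>2 \<le> (3 * D\<^sup>2) * \<nu>\<^sup>2"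
    using D2 by (intro mult_right_mono) auto
  have B: "(0.5 * D + P * D + 2 * P + 1.5) * \<nu> \<le> (5 * D\<^sup>2 * \<nu>) * \<nu>"
  proof (rule mult_right_mono)
    have "P * D \<le> \<nu> * D\<^sup>2" "P * 1 \<le> \<nu> * D\<^sup>2" "D * 1 \<le> D\<^sup>2 * \<nu>" "1 * 1 \<le> D\<^sup>2 * \<nu>"
      using bounds D2 by (intro mult_mono; simp)+
    then show "0.5 * D + P * D + 2 * P + 1.5 \<le> 5 * D\<^sup>2 * \<nu>" by (simp add: mult.commute)
  qed (use bounds in simp)
  have C: "0 \<le> (0.5 * D\<^sup>2 + D + 1.5) * \<nu>\<^sup>2 + (0.5 * D + P * D + 2 * P + 1.5) * \<nu>"
    using bounds by simp
  have "norm ((0.5 * D\<^sup>2 + D + 1.5) * \<nu>\<^sup>2 + (0.5 * D + P * D + 2 * P + 1.5) * \<nu>) \<le> 3 * D\<^sup>2 * \<nu>\<^sup>2 + 5 * D\<^sup>2 * \<nu> * \<nu>"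
    unfolding real_norm_def abs_of_nonneg[OF C] using A B by (rule add_mono)
  also have "\<dots> = 8 * norm (D\<^sup>2 * \<nu>\<^sup>2)"
    by (simp add: power2_eq_square)
  finally show "norm (let \<nu> = real n + real p in
      (0.5 * (real d)\<^sup>2 + real d + 1.5) * \<nu>\<^sup>2
      + (0.5 * real d + real p * real d + 2 * real p + 1.5) * \<nu>)
    \<le> 8 * norm ((real d)\<^sup>2 * (real n + real p)\<^sup>2)"
    unfolding Let_def D_def \<nu>_def P_def .
qed

section \<open>Kernel and matrix inequality\<close>

lemma bounded_linear_blk: "bounded_linear (\<lambda>y. blk y i)"
  unfolding linear_conv_bounded_linear[symmetric]
  by (rule linearI) (auto simp: blk_def vec_eq_iff)

lemma bounded_linear_vkron: "bounded_linear (\<lambda>v. vkron v Y)"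
  unfolding linear_conv_bounded_linear[symmetric]
  by (rule linearI) (auto simp: vkron_def vec_eq_iff algebra_simps)

text \<open>The mixed-product rule, verified block by block.\<close>

lemma kron_mult_vkron: "(Y \<otimes> mat 1) ** vkron v (mat 1) = vkron (Y *v v) (mat 1)"
proof (subst matrix_eq, intro allI)
  fix x
  show "((Y \<otimes> mat 1) ** vkron v (mat 1)) *v x = vkron (Y *v v) (mat 1) *v x"
    unfolding blk_eq_iff matrix_vector_mul_assoc[symmetric] blk_kron
    by (simp add: matrix_vector_mult_def[of Y] scaleR_sum_left)
qed

section \<open>The normalised kernel\<close>

context
  fixes r :: real and f :: "real \<Rightarrow> real^'d" and M :: "real^'d^'d"
  assumes f_ode: "\<And>\<tau>. \<tau> \<in> {-r..0} \<Longrightarrow> (f has_vector_derivative M *v f \<tau>) (at \<tau> within {-r..0})"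
    and gram_pos: "pos_def (gram r f)"
begin

text \<open>With T the root of the inverse Gram matrix, T f satisfies the equation of f conjugated
  by T, and the inverse of T is the root of the Gram matrix. This is the origin of the third block
  of \<open>bold_F\<close>.\<close>

lemma Fker_has_vector_derivative:
  assumes "\<tau> \<in> {-r..0}"
  shows "((Fker r f :: real \<Rightarrow> real^'k^('d \<times> 'k)) has_vector_derivative
    ((mat_sqrt (matrix_inv (gram r f)) ** M ** mat_sqrt (gram r f)) \<otimes> mat 1) ** Fker r f \<tau>)
    (at \<tau> within {-r..0})"
proof -
  let ?T = "mat_sqrt (matrix_inv (gram r f))" and ?W = "mat_sqrt (gram r f)"
  have "((\<lambda>\<tau>. vkron (?T *v f \<tau>) (mat 1) :: real^'k^('d \<times> 'k)) has_vector_derivative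
      vkron (?T *v (M *v f \<tau>)) (mat 1)) (at \<tau> within {-r..0})"
    by (intro bounded_linear.has_vector_derivative[OF bounded_linear_vkron]
        bounded_linear.has_vector_derivative[OF matrix_vector_mul_bounded_linear] f_ode assms)
  moreover have "?T *v (M *v f \<tau>) = (?T ** M ** ?W) *v (?T *v f \<tau>)"
  proof -
    have "(?T ** M ** ?W) *v (?T *v f \<tau>) = (?T ** M ** (?W ** ?T)) *v f \<tau>"
      by (simp add: matrix_vector_mul_assoc matrix_mul_assoc)
    then show ?thesis
      by (simp add: mat_sqrt_matrix_inv(1)[OF gram_pos] matrix_vector_mul_assoc)
  qed
  ultimately show ?thesis
    by (simp add: Fker_def[abs_def] kron_mult_vkron)
qed

lemma continuous_on_Fker: "continuous_on {-r..0} (Fker r f :: real \<Rightarrow> real^'k^('d \<times> 'k))"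
  using Fker_has_vector_derivative by (rule continuous_on_vector_derivative)

text \<open>The Gram matrix of T f is T times that of f times T, since T is symmetric; this is the
  identity because T is the inverse of the root of that Gram matrix.\<close>

lemma kernel_orthonormal:
  defines "g \<equiv> \<lambda>\<tau>. mat_sqrt (matrix_inv (gram r f)) *v f \<tau>"
  shows "((\<lambda>\<tau>. g \<tau> $ i * g \<tau> $ j) has_integral (if i = j then 1 else 0)) {-r..0}"
proof -
  let ?T = "mat_sqrt (matrix_inv (gram r f))" and ?W = "mat_sqrt (gram r f)"
  have outer: "((columnvector u :: real^1^'d) ** rowvector v) $ i $ j = u $ i * v $ j" for u v :: "real^'d" and i j
    by (simp add: matrix_matrix_mult_def columnvector_def rowvector_def)
  have contf: "continuous_on {-r..0} f"
    using f_ode by (rule continuous_on_vector_derivative)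
  have "continuous_on {-r..0} (\<lambda>\<tau>. (columnvector (f \<tau>) :: real^1^'d) ** rowvector (f \<tau>))"
    unfolding continuous_on_componentwise[where 'b = "real^'d^'d"]
    using contf by (auto simp: Basis_vec_def inner_axis inner_axis' outer intro!: continuous_intros)
  then have gram: "((\<lambda>\<tau>. (columnvector (f \<tau>) :: real^1^'d) ** rowvector (f \<tau>)) has_integral gram r f) {-r..0}"
    unfolding gram_def by (intro integrable_integral integrable_continuous_interval)
  have "bounded_linear (\<lambda>X. (?T ** X ** ?T) $ i $ j)"
    unfolding linear_conv_bounded_linear[symmetric]
    by (rule linearI) (simp_all add: matrix_matrix_mult_def sum_distrib_left sum_distrib_right algebra_simps sum.distrib)
  from has_integral_linear[OF gram this]
  have "((\<lambda>\<tau>. (?T ** ((columnvector (f \<tau>) :: real^1^'d) ** rowvector (f \<tau>)) ** ?T) $ i $ j)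
      has_integral (?T ** gram r f ** ?T) $ i $ j) {-r..0}"
    by (simp add: comp_def)
  moreover have "(?T ** ((columnvector (f \<tau>) :: real^1^'d) ** rowvector (f \<tau>)) ** ?T) $ i $ j = g \<tau> $ i * g \<tau> $ j" for \<tau>
  proof -
    have "?T $ k $ l = ?T $ l $ k" for k l
      using pos_def_mat_sqrt[OF pos_def_matrix_inv[OF gram_pos]]
      by (simp add: pos_def_def sym_mat_def transpose_def vec_eq_iff)
    then show ?thesis
      by (simp add: g_def matrix_matrix_mult_def[of _ ?T] matrix_matrix_mult_def[of ?T] outer matrix_vector_mult_def
          sum_distrib_left sum_distrib_right mult_ac)
  qed
  moreover have "?T ** gram r f ** ?T = mat 1"
  proof -
    have "?T ** gram r f ** ?T = (?T ** ?W) ** (?W ** ?T)"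
      by (metis mat_sqrt_square[OF gram_pos] matrix_mul_assoc)
    then show ?thesis by (simp add: mat_sqrt_matrix_inv[OF gram_pos])
  qed
  ultimately show ?thesis by (simp add: mat_def)
qed

text \<open>The blocks of y are the Fourier coefficients of \<phi> with respect to the orthonormal
  components of the kernel, so the Kronecker form is the sum in
  \<open>orthonormal_bessel\<close>.\<close>

lemma Fker_bessel:
  fixes \<phi> :: "real \<Rightarrow> real^'k" and W :: "real^'k^'k"
  assumes \<phi>: "continuous_on {-r..0} \<phi>" and W: "sym_mat W" "\<And>v. v \<bullet> (W *v v) \<ge> 0"
  defines "y \<equiv> integral {-r..0} (\<lambda>\<tau>. Fker r f \<tau> *v \<phi> \<tau>)"
  shows "y \<bullet> ((mat 1 \<otimes> W) *v y) \<le> integral {-r..0} (\<lambda>\<tau>. \<phi> \<tau> \<bullet> (W *v \<phi> \<tau>))"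
proof -
  let ?g = "\<lambda>\<tau>. mat_sqrt (matrix_inv (gram r f)) *v f \<tau>"
  have contf: "continuous_on {-r..0} f"
    using f_ode by (rule continuous_on_vector_derivative)
  have blk_y: "blk y i = integral {-r..0} (\<lambda>\<tau>. ?g \<tau> $ i *\<^sub>R \<phi> \<tau>)" for i
  proof -
    have "(\<lambda>\<tau>. Fker r f \<tau> *v \<phi> \<tau>) integrable_on {-r..0}"
      by (intro integrable_continuous_interval bounded_bilinear.continuous_on[OF bounded_bilinear_matrix_vector_mult]
          continuous_on_Fker \<phi>)
    from integral_linear[OF this bounded_linear_blk[of i]] show ?thesis
      by (simp add: comp_def y_def Fker_def)
  qed
  have "y \<bullet> ((mat 1 \<otimes> W) *v y) = (\<Sum>i\<in>UNIV. blk y i \<bullet> (W *v blk y i))"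
    by (simp add: inner_eq_sum_blk)
  also have "\<dots> \<le> integral {-r..0} (\<lambda>\<tau>. \<phi> \<tau> \<bullet> (W *v \<phi> \<tau>))"
    unfolding blk_y
    by (intro orthonormal_bessel \<phi> W kernel_orthonormal contf
        linear_continuous_on_compose[OF _ matrix_vector_mul_linear])
  finally show ?thesis .
qed

end

section \<open>From the matrix inequality to a dissipation inequality\<close>

lemma bold_Pi_mult:
  "bold_Pi A B D1 D2 K1 K2 K3 *v vec_join x (vec_join xr (vec_join y w)) =
    ((A ||| 0) /// K1) *v x + ((0 ||| B) /// K2) *v xr + (0 /// K3) *v y + (D1 /// D2) *v w"
  by (simp add: bold_Pi_def bold_A_def bold_B_def bold_K_def matrix_vector_mult_add_rdistrib
      matrix_vector_mul_assoc[symmetric] algebra_simps)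

lemma bold_Sigma_mult:
  "bold_Sigma C1 C2 C3 D3 *v vec_join x (vec_join xr (vec_join y w)) =
    C1 *v x + C2 *v xr + C3 *v y + D3 *v w"
  by (simp add: bold_Sigma_def add.assoc)

lemma Sy_mult_form: "a \<bullet> (Sy (V ** H) *v a) = 2 * ((transpose V *v a) \<bullet> (H *v a))"
  using inner_matrix_transpose[of a V "H *v a"] by (simp only: Sy_form matrix_vector_mul_assoc)

text \<open>The Schur complement is undone by evaluating the last \<open>m\<close> coordinates at
  \<open>- matrix_inv J1 *v (Jt *v z)\<close>.\<close>

lemma lmi_dissipation:
  fixes FF :: "real^('k::finite, 'd::finite, 'q::finite) aug^('d \<times> 'k)"
    and \<Sigma> :: "real^('k, 'd, 'q) aug^'m" and Pm :: "real^('k, 'd, 'q) aug^'k"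
    and x xr :: "real^'k" and w :: "real^'q"
  assumes lmi: "\<And>a. a \<bullet> ((bold_Phi r FF \<Sigma> Jt J1 J2 J3 Q R S U
      + Sy (transpose (bold_P P Q) ** (Pm ||| 0))) *v a) \<le> - e * (norm a)\<^sup>2"
    and "e > 0" "invertible J1"
  shows "let \<xi> = vec_join x (vec_join xr (vec_join y w)) in
      2 * ((P *v x + Q *v y) \<bullet> (Pm *v \<xi>) + x \<bullet> (Q *v (FF *v \<xi>)) + y \<bullet> (R *v (FF *v \<xi>)))
      + x \<bullet> ((S + r *\<^sub>R U) *v x) - xr \<bullet> (S *v xr) - y \<bullet> ((mat 1 \<otimes> U) *v y)
      - supply_rate Jt J1 J2 J3 (\<Sigma> *v \<xi>) w
      \<le> - e * ((norm x)\<^sup>2 + (norm y)\<^sup>2)"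
proof -
  define \<xi> where "\<xi> = vec_join x (vec_join xr (vec_join y w))"
  define z where "z = \<Sigma> *v \<xi>"
  define \<zeta> where "\<zeta> = - (matrix_inv J1 *v (Jt *v z))"
  define a where "a = vec_join \<xi> \<zeta>"
  \<comment> \<open>\<zeta> is the stationary point of the form in its last coordinates: there
    \<zeta> . J1 \<zeta> + 2 \<zeta> . Jt z reduces to \<zeta> . Jt z, which is minus the term of
    the supply rate quadratic in z.\<close>
  have J1_\<zeta>: "J1 *v \<zeta> = - (Jt *v z)"
  proof -
    have "J1 *v (matrix_inv J1 *v u) = u" for u
      by (simp add: matrix_vector_mul_assoc matrix_inv_invertible(1)[OF \<open>invertible J1\<close>])
    then show ?thesis by (simp add: \<zeta>_def matrix_vector_mult_minus)
  qed
  have inner_T: "(transpose Y *v u) \<bullet> v = u \<bullet> (Y *v v)" for Y :: "real^'x^'y" and u v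
    by (rule inner_matrix_transpose[symmetric])
  have "a \<bullet> (Sy (transpose (bold_P P Q) ** (Pm ||| 0)) *v a) = 2 * ((P *v x + Q *v y) \<bullet> (Pm *v \<xi>))"
    unfolding Sy_mult_form transpose_transpose by (simp add: a_def bold_P_def) (simp add: \<xi>_def)
  moreover have "a \<bullet> (Sy (((Q /// 0 /// R /// 0) /// 0) ** (FF ||| 0)) *v a) =
      2 * (x \<bullet> (Q *v (FF *v \<xi>)) + y \<bullet> (R *v (FF *v \<xi>)))"
  proof -
    have "a \<bullet> (Sy (((Q /// 0 /// R /// 0) /// 0) ** (FF ||| 0)) *v a) =
        2 * (a \<bullet> (((Q /// 0 /// R /// 0) /// 0) *v ((FF ||| 0) *v a)))"
      by (simp only: Sy_form matrix_vector_mul_assoc)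
    also have "(FF ||| 0) *v a = FF *v \<xi>" by (simp add: a_def)
    finally show ?thesis by (simp add: a_def) (simp add: \<xi>_def)
  qed
  moreover have "a \<bullet> ((((S + r *\<^sub>R U) \<oplus> (- S) \<oplus> (- (mat 1 \<otimes> U)) \<oplus> (- J3)) \<oplus> J1) *v a) =
      x \<bullet> ((S + r *\<^sub>R U) *v x) - xr \<bullet> (S *v xr) - y \<bullet> ((mat 1 \<otimes> U) *v y) - w \<bullet> (J3 *v w)
      - \<zeta> \<bullet> (Jt *v z)"
    by (simp add: a_def \<xi>_def J1_\<zeta>)
  moreover have "a \<bullet> (Sy (transpose ((0 ||| 0 ||| 0 ||| - J2) ||| transpose Jt) ** (\<Sigma> ||| 0)) *v a) =
      2 * (\<zeta> \<bullet> (Jt *v z) - z \<bullet> (J2 *v w))"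
  proof -
    have "(transpose Jt *v \<zeta>) \<bullet> z = \<zeta> \<bullet> (Jt *v z)" by (rule inner_T)
    moreover have "((0 ||| 0 ||| 0 ||| - J2) ||| transpose Jt) *v a = - (J2 *v w) + transpose Jt *v \<zeta>"
      by (simp add: a_def \<xi>_def del: transpose_matrix_vector)
    moreover have "(\<Sigma> ||| 0) *v a = z" by (simp add: a_def z_def)
    ultimately show ?thesis
      unfolding Sy_mult_form transpose_transpose
      by (simp add: inner_diff_left inner_commute[of z] del: transpose_matrix_vector)
  qed
  moreover have "supply_rate Jt J1 J2 J3 z w = - (\<zeta> \<bullet> (Jt *v z)) + 2 * (z \<bullet> (J2 *v w)) + w \<bullet> (J3 *v w)"
  proof -
    have "z \<bullet> ((transpose Jt ** matrix_inv J1 ** Jt) *v z) = - (\<zeta> \<bullet> (Jt *v z))"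
      using inner_matrix_transpose[of z "transpose Jt" "matrix_inv J1 *v (Jt *v z)"]
      by (simp add: matrix_vector_mul_assoc[symmetric] \<zeta>_def inner_commute del: transpose_matrix_vector)
    moreover have "w \<bullet> (transpose J2 *v z) = z \<bullet> (J2 *v w)"
      using inner_T[of J2 z w] by (simp add: inner_commute del: transpose_matrix_vector)
    ultimately show ?thesis
      by (simp add: supply_rate_def inner_add_right del: transpose_matrix_vector)
  qed
  ultimately have form: "a \<bullet> ((bold_Phi r FF \<Sigma> Jt J1 J2 J3 Q R S U + Sy (transpose (bold_P P Q) ** (Pm ||| 0))) *v a) =
    2 * ((P *v x + Q *v y) \<bullet> (Pm *v \<xi>) + x \<bullet> (Q *v (FF *v \<xi>)) + y \<bullet> (R *v (FF *v \<xi>)))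
    + x \<bullet> ((S + r *\<^sub>R U) *v x) - xr \<bullet> (S *v xr) - y \<bullet> ((mat 1 \<otimes> U) *v y)
    - supply_rate Jt J1 J2 J3 z w"
    by (simp only: bold_Phi_def matrix_vector_mult_add_rdistrib inner_add_right) simp
  \<comment> \<open>Of the margin only the share of x and y is kept, the one that later absorbs
    terms in the decay estimate.\<close>
  have "(norm a)\<^sup>2 \<ge> (norm x)\<^sup>2 + (norm y)\<^sup>2"
    by (simp add: a_def \<xi>_def norm_vec_join)
  then have "- e * (norm a)\<^sup>2 \<le> - e * ((norm x)\<^sup>2 + (norm y)\<^sup>2)"
    using \<open>e > 0\<close> by simp
  with lmi[of a, unfolded form] show ?thesis
    unfolding Let_def \<xi>_def[symmetric] z_def[symmetric] by (rule order_trans)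
qed

section \<open>The closed-loop system\<close>

lemma continuous_on_form:
  fixes \<phi> :: "real \<Rightarrow> real^'k"
  assumes "continuous_on A \<phi>" "continuous_on A W"
  shows "continuous_on A (\<lambda>\<tau>. \<phi> \<tau> \<bullet> (W \<tau> *v \<phi> \<tau>))"
  by (intro continuous_on_inner bounded_bilinear.continuous_on[OF bounded_bilinear_matrix_vector_mult] assms)

section \<open>Two-sided bounds on the functional\<close>

context
  fixes r :: real and f :: "real \<Rightarrow> real^'d" and M :: "real^'d^'d"
  assumes r_pos: "r > 0"
    and f_ode: "\<And>\<tau>. \<tau> \<in> {-r..0} \<Longrightarrow> (f has_vector_derivative M *v f \<tau>) (at \<tau> within {-r..0})"
    and gram_pos: "pos_def (gram r f)"
begin

text \<open>Bessel's inequality with weight S extracts from the integral exactly the summand I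
  \<otimes> S by which the assumed block matrix exceeds the quadratic form in \<phi>(0) and y. The
  remaining U-term is nonnegative.\<close>

lemma krasovskii_lower_bound:
  fixes P :: "real^'k^'k" and Q :: "real^('d \<times> 'k)^'k"
  assumes pd: "pos_def ((P ||| Q) /// (transpose Q ||| R + mat 1 \<otimes> S))" and "pos_def S" "pos_def U"
  obtains c where "c > 0"
    "\<And>\<phi>. continuous_on {-r..0} \<phi> \<Longrightarrow> c * (norm (\<phi> 0))\<^sup>2 \<le> krasovskii r (Fker r f) P Q R S U \<phi>"
proof -
  obtain c where "c > 0" and c: "\<And>v. v \<bullet> (((P ||| Q) /// (transpose Q ||| R + mat 1 \<otimes> S)) *v v) \<ge> c * (norm v)\<^sup>2"
    using pos_defD_coercive[OF pd] by blast
  have S: "sym_mat S" "\<And>v. v \<bullet> (S *v v) \<ge> 0" and U: "\<And>v. v \<bullet> (U *v v) \<ge> 0"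
    using assms(2,3) by (metis pos_def_def inner_zero_left less_eq_real_def)+
  have "c * (norm (\<phi> 0))\<^sup>2 \<le> krasovskii r (Fker r f) P Q R S U \<phi>" if \<phi>: "continuous_on {-r..0} \<phi>" for \<phi>
  proof -
    define y where "y = integral {-r..0} (\<lambda>\<tau>. Fker r f \<tau> *v \<phi> \<tau>)"
    have "c * (norm (\<phi> 0))\<^sup>2 \<le> c * (norm (vec_join (\<phi> 0) y))\<^sup>2"
      using \<open>c > 0\<close> by (simp add: norm_vec_join)
    also have "\<dots> \<le> vec_join (\<phi> 0) y \<bullet> (((P ||| Q) /// (transpose Q ||| R + mat 1 \<otimes> S)) *v vec_join (\<phi> 0) y)"
      by (rule c)
    also have "\<dots> = \<phi> 0 \<bullet> (P *v \<phi> 0) + 2 * (\<phi> 0 \<bullet> (Q *v y)) + y \<bullet> (R *v y) + y \<bullet> ((mat 1 \<otimes> S) *v y)"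
      using inner_matrix_transpose[of "\<phi> 0" Q y]
      by (simp add: inner_add_right matrix_vector_mult_add_rdistrib inner_commute[of y] del: transpose_matrix_vector)
    also have "y \<bullet> ((mat 1 \<otimes> S) *v y) \<le> integral {-r..0} (\<lambda>\<tau>. \<phi> \<tau> \<bullet> (S *v \<phi> \<tau>))"
      unfolding y_def by (rule Fker_bessel[OF f_ode gram_pos \<phi> S])
    also have "\<dots> \<le> integral {-r..0} (\<lambda>\<tau>. \<phi> \<tau> \<bullet> ((S + (\<tau> + r) *\<^sub>R U) *v \<phi> \<tau>))"
    proof (rule integral_le)
      show "(\<lambda>\<tau>. \<phi> \<tau> \<bullet> (S *v \<phi> \<tau>)) integrable_on {-r..0}"
        "(\<lambda>\<tau>. \<phi> \<tau> \<bullet> ((S + (\<tau> + r) *\<^sub>R U) *v \<phi> \<tau>)) integrable_on {-r..0}"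
        by (intro integrable_continuous_interval continuous_on_form \<phi> continuous_intros)+
    qed (use U in \<open>simp add: matrix_vector_mult_add_rdistrib inner_add_right\<close>)
    finally show ?thesis by (simp add: krasovskii_def y_def Let_def)
  qed
  then show ?thesis using that \<open>c > 0\<close> by blast
qed

lemma norm_Fker_integral_le:
  fixes \<phi> :: "real \<Rightarrow> real^'k"
  assumes \<phi>: "continuous_on {-r..0} \<phi>"
  shows "(norm (integral {-r..0} (\<lambda>\<tau>. Fker r f \<tau> *v \<phi> \<tau>)))\<^sup>2 \<le> integral {-r..0} (\<lambda>\<tau>. (norm (\<phi> \<tau>))\<^sup>2)"
proof -
  have "(mat 1 \<otimes> mat 1) *v y = y" for y :: "real^('d \<times> 'k)"
    unfolding blk_eq_iff by simp
  then show ?thesis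
    using Fker_bessel[OF f_ode gram_pos \<phi>, of "mat 1"] by (simp add: sym_mat_def power2_norm_eq_inner)
qed

lemma krasovskii_upper_bound:
  fixes P :: "real^'k^'k" and Q :: "real^('d \<times> 'k)^'k"
  assumes "pos_def U"
  obtains c where "c > 0"
    "\<And>\<phi>. continuous_on {-r..0} \<phi> \<Longrightarrow>
      krasovskii r (Fker r f) P Q R S U \<phi> \<le> c * ((norm (\<phi> 0))\<^sup>2 + integral {-r..0} (\<lambda>\<tau>. (norm (\<phi> \<tau>))\<^sup>2))"
proof -
  \<comment> \<open>Here R stands alone, because the S-integral is estimated directly instead of
    through y.\<close>
  obtain c1 where "c1 > 0" and c1: "\<And>v. v \<bullet> (((P ||| Q) /// (transpose Q ||| R)) *v v) \<le> c1 * (norm v)\<^sup>2"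
    using quadratic_form_bound by blast
  obtain c2 where "c2 > 0" and c2: "\<And>v. v \<bullet> ((S + r *\<^sub>R U) *v v) \<le> c2 * (norm v)\<^sup>2"
    using quadratic_form_bound by blast
  have U: "v \<bullet> (U *v v) \<ge> 0" for v
    using assms by (metis pos_def_def inner_zero_left less_eq_real_def)
  have "krasovskii r (Fker r f) P Q R S U \<phi> \<le> (c1 + c2) * ((norm (\<phi> 0))\<^sup>2 + integral {-r..0} (\<lambda>\<tau>. (norm (\<phi> \<tau>))\<^sup>2))"
    if \<phi>: "continuous_on {-r..0} \<phi>" for \<phi>
  proof -
    define y where "y = integral {-r..0} (\<lambda>\<tau>. Fker r f \<tau> *v \<phi> \<tau>)"
    let ?I = "integral {-r..0} (\<lambda>\<tau>. (norm (\<phi> \<tau>))\<^sup>2)"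
    have norm_int: "(\<lambda>\<tau>. (norm (\<phi> \<tau>))\<^sup>2) integrable_on {-r..0}"
      by (intro integrable_continuous_interval continuous_intros \<phi>)
    have "\<phi> 0 \<bullet> (P *v \<phi> 0) + 2 * (\<phi> 0 \<bullet> (Q *v y)) + y \<bullet> (R *v y)
        = vec_join (\<phi> 0) y \<bullet> (((P ||| Q) /// (transpose Q ||| R)) *v vec_join (\<phi> 0) y)"
      using inner_matrix_transpose[of "\<phi> 0" Q y]
      by (simp add: inner_add_right inner_commute[of y] del: transpose_matrix_vector)
    also have "\<dots> \<le> c1 * (norm (vec_join (\<phi> 0) y))\<^sup>2" by (rule c1)
    also have "\<dots> \<le> c1 * ((norm (\<phi> 0))\<^sup>2 + ?I)"
      using norm_Fker_integral_le[OF \<phi>] \<open>c1 > 0\<close> by (simp add: norm_vec_join y_def)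
    finally have "\<phi> 0 \<bullet> (P *v \<phi> 0) + 2 * (\<phi> 0 \<bullet> (Q *v y)) + y \<bullet> (R *v y) \<le> c1 * ((norm (\<phi> 0))\<^sup>2 + ?I)" .
    moreover have "integral {-r..0} (\<lambda>\<tau>. \<phi> \<tau> \<bullet> ((S + (\<tau> + r) *\<^sub>R U) *v \<phi> \<tau>)) \<le> integral {-r..0} (\<lambda>\<tau>. c2 * (norm (\<phi> \<tau>))\<^sup>2)"
    proof (rule integral_le)
      show "(\<lambda>\<tau>. \<phi> \<tau> \<bullet> ((S + (\<tau> + r) *\<^sub>R U) *v \<phi> \<tau>)) integrable_on {-r..0}"
        "(\<lambda>\<tau>. c2 * (norm (\<phi> \<tau>))\<^sup>2) integrable_on {-r..0}"
        by (intro integrable_continuous_interval continuous_on_form \<phi> continuous_intros)+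
      fix \<tau> assume "\<tau> \<in> {-r..0}"
      then have "(\<tau> + r) * (\<phi> \<tau> \<bullet> (U *v \<phi> \<tau>)) \<le> r * (\<phi> \<tau> \<bullet> (U *v \<phi> \<tau>))"
        using U by (intro mult_right_mono) auto
      then show "\<phi> \<tau> \<bullet> ((S + (\<tau> + r) *\<^sub>R U) *v \<phi> \<tau>) \<le> c2 * (norm (\<phi> \<tau>))\<^sup>2"
        using c2[of "\<phi> \<tau>"] by (simp add: matrix_vector_mult_add_rdistrib inner_add_right)
    qed
    moreover have "0 \<le> c2 * (norm (\<phi> 0))\<^sup>2" using \<open>c2 > 0\<close> by simp
    ultimately show ?thesis by (simp add: krasovskii_def y_def[symmetric] Let_def algebra_simps)
  qed
  then show ?thesis using that[of "c1 + c2"] \<open>c1 > 0\<close> \<open>c2 > 0\<close> by simp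
qed

end

text \<open>Glues the initial function on the left of t0 to the absolutely continuous part on the
  right.\<close>

lemma cls_continuous_on:
  assumes "cls r t0 A B D1 D2 D3 C1 C2 C3 F K1 K2 K3 \<phi> w x z" "r \<ge> 0"
  shows "continuous_on {t0 - r..} x"
proof -
  have cls: "continuous_on {-r..0} \<phi>" "\<forall>\<theta>\<in>{-r..0}. x (t0 + \<theta>) = \<phi> \<theta>" "\<forall>T\<ge>t0. abs_cont_on t0 T x"
    using assms(1) by (auto simp: cls_def)
  have "continuous_on {t0 - r..t0} (\<lambda>s. \<phi> (s - t0))"
    by (intro continuous_on_compose2[OF cls(1)] continuous_intros) auto
  moreover have "\<phi> (s - t0) = x s" if "s \<in> {t0 - r..t0}" for s
    using cls(2)[rule_format, of "s - t0"] that by simp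
  ultimately have left: "continuous_on {t0 - r..t0} x"
    by (rule continuous_on_eq)
  \<comment> \<open>Absolute continuity is given only on bounded intervals. Clamping the argument at
    t0 - r extends x to the whole line, where continuity can be checked point by point.\<close>
  have "isCont (\<lambda>s. x (max (t0 - r) s)) s" for s
  proof -
    define T where "T = max t0 (s + 1)"
    have "abs_cont_on t0 T x" using cls(3) by (simp add: T_def)
    then have "continuous_on ({t0 - r..t0} \<union> {t0..T}) x"
      by (intro continuous_on_closed_Un left abs_cont_on_imp_continuous_on) auto
    moreover have "{t0 - r..t0} \<union> {t0..T} = {t0 - r..T}"
      using \<open>r \<ge> 0\<close> by (auto simp: T_def)
    ultimately have contT: "continuous_on {t0 - r..T} x" by simp
    have "continuous_on {..<T} (\<lambda>s. x (max (t0 - r) s))"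
    proof (rule continuous_on_compose2[OF contT])
      show "continuous_on {..<T} (max (t0 - r))"
        by (intro continuous_on_max continuous_on_const continuous_on_id)
      have "t0 - r \<le> T" using \<open>r \<ge> 0\<close> by (simp add: T_def)
      then show "max (t0 - r) ` {..<T} \<subseteq> {t0 - r..T}" by auto
    qed
    moreover have "s \<in> {..<T}" by (auto simp: T_def)
    ultimately show ?thesis
      by (simp add: continuous_on_eq_continuous_at)
  qed
  then have "continuous_on {t0 - r..} (\<lambda>s. x (max (t0 - r) s))"
    by (intro continuous_at_imp_continuous_on) auto
  then show ?thesis
    by (rule continuous_on_eq) (simp add: max_def)
qed

definition aug_state ::
  "real \<Rightarrow> (real \<Rightarrow> real^'k^('d \<times> 'k)) \<Rightarrow> (real \<Rightarrow> real^'k) \<Rightarrow> real^'q \<Rightarrow> real \<Rightarrow> real^('k::finite, 'd::finite, 'q::finite) aug" where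
  "aug_state r F x w t =
    vec_join (x t) (vec_join (x (t - r)) (vec_join (integral {-r..0} (\<lambda>\<tau>. F \<tau> *v x (t + \<tau>))) w))"

lemma cls_augmented:
  fixes F :: "real \<Rightarrow> real^('n::finite + 'p::finite)^('d::finite \<times> ('n + 'p))"
  assumes cls: "cls r t0 A B D1 D2 D3 C1 C2 C3 F K1 K2 K3 \<phi> w x z" and "r \<ge> 0"
    and F: "continuous_on {-r..0} F"
  shows "AE t in lebesgue. t \<ge> t0 \<longrightarrow>
      (x has_vector_derivative bold_Pi A B D1 D2 K1 K2 K3 *v aug_state r F x (w t) t) (at t)"
    and "AE t in lebesgue. t \<ge> t0 \<longrightarrow> z t = bold_Sigma C1 C2 C3 D3 *v aug_state r F x (w t) t"
proof -
  have x: "continuous_on {t0 - r..} x" by (rule cls_continuous_on[OF cls \<open>r \<ge> 0\<close>])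
  have int: "integral {-r..0} (\<lambda>\<tau>. (Y ** F \<tau>) *v x (t + \<tau>)) = Y *v integral {-r..0} (\<lambda>\<tau>. F \<tau> *v x (t + \<tau>))"
    if "t \<ge> t0" for t and Y :: "real^('d \<times> ('n + 'p))^'y"
  proof -
    have "(\<lambda>\<tau>. F \<tau> *v x (t + \<tau>)) integrable_on {-r..0}"
      by (intro integrable_continuous_interval bounded_bilinear.continuous_on[OF bounded_bilinear_matrix_vector_mult]
          F continuous_on_compose2[OF x] continuous_intros) (use that in auto)
    from integral_linear[OF this matrix_vector_mul_bounded_linear[of Y]] show ?thesis
      by (simp add: comp_def matrix_vector_mul_assoc)
  qed
  have AE: "AE t in lebesgue. t \<ge> t0 \<longrightarrow>
        (x has_vector_derivative
           (((A ||| 0) /// K1) *v x t + ((0 ||| B) /// K2) *v x (t - r)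
            + integral {-r..0} (\<lambda>\<tau>. ((0 /// K3) ** F \<tau>) *v x (t + \<tau>))
            + (D1 /// D2) *v w t)) (at t)"
    "AE t in lebesgue. t \<ge> t0 \<longrightarrow>
        z t = C1 *v x t + C2 *v x (t - r)
              + integral {-r..0} (\<lambda>\<tau>. (C3 ** F \<tau>) *v x (t + \<tau>)) + D3 *v w t"
    using cls unfolding cls_def by - (elim conjE, assumption)+
  show "AE t in lebesgue. t \<ge> t0 \<longrightarrow>
      (x has_vector_derivative bold_Pi A B D1 D2 K1 K2 K3 *v aug_state r F x (w t) t) (at t)"
    unfolding aug_state_def bold_Pi_mult using AE(1)
    by (rule eventually_mono) (intro impI, drule (1) mp, simp only: int)
  show "AE t in lebesgue. t \<ge> t0 \<longrightarrow> z t = bold_Sigma C1 C2 C3 D3 *v aug_state r F x (w t) t"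
    unfolding aug_state_def bold_Sigma_mult using AE(2)
    by (rule eventually_mono) (intro impI, drule (1) mp, simp only: int)
qed

text \<open>Without disturbance the right-hand side h is continuous in t. Absolute continuity makes
  x the integral of h, and the integral of a continuous function is differentiable at every point,
  from the right at t0.\<close>

lemma cls_undisturbed_has_derivative:
  assumes cls: "cls r t0 A B D1 D2 D3 C1 C2 C3 F K1 K2 K3 \<phi> (\<lambda>_. 0) x z" and "r \<ge> 0"
    and F: "\<And>\<tau>. \<tau> \<in> {-r..0} \<Longrightarrow> (F has_vector_derivative N ** F \<tau>) (at \<tau> within {-r..0})"
    and "t \<ge> t0"
  shows "(x has_vector_derivative bold_Pi A B D1 D2 K1 K2 K3 *v aug_state r F x 0 t) (at t within {t0..})"
proof -
  define h where "h t = bold_Pi A B D1 D2 K1 K2 K3 *v aug_state r F x 0 t" for t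
  have contF: "continuous_on {-r..0} F"
    using F by (rule continuous_on_vector_derivative)
  have contNF: "continuous_on {-r..0} (\<lambda>\<tau>. N ** F \<tau>)"
    using contF unfolding matrix_matrix_mult_def by (intro continuous_intros)
  have x: "continuous_on {t0 - r..} x" by (rule cls_continuous_on[OF cls \<open>r \<ge> 0\<close>])
  have "continuous_on {t0..} (\<lambda>t. integral {-r..0} (\<lambda>\<tau>. F \<tau> *v x (t + \<tau>)))"
    by (rule continuous_on_vector_derivative)
      (rule moving_integral_has_vector_derivative[OF bounded_bilinear_matrix_vector_mult \<open>r \<ge> 0\<close> _ F contNF x], auto)
  moreover have "continuous_on {t0..} x" "continuous_on {t0..} (\<lambda>t. x (t - r))"
    using \<open>r \<ge> 0\<close> by (auto intro!: continuous_on_compose2[OF x] continuous_on_subset[OF x] continuous_intros)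
  ultimately have h: "continuous_on {t0..} h"
    unfolding h_def aug_state_def bold_Pi_mult
    by (intro continuous_on_add linear_continuous_on_compose[OF _ matrix_vector_mul_linear] continuous_on_const)
  have "AE t in lebesgue. t \<ge> t0 \<longrightarrow> (x has_vector_derivative h t) (at t)"
    unfolding h_def by (rule cls_augmented(1)[OF cls \<open>r \<ge> 0\<close> contF])
  then obtain N where N: "N \<in> null_sets lebesgue"
    and N_sub: "{s \<in> space lebesgue. \<not> (s \<ge> t0 \<longrightarrow> (x has_vector_derivative h s) (at s))} \<subseteq> N"
    unfolding eventually_ae_filter by blast
  have deriv: "(x has_vector_derivative h s) (at s)" if "s \<notin> N" "s \<ge> t0" for s
    using subsetD[OF N_sub, of s] that by auto
  have x_eq: "x s = x t0 + integral {t0..s} h" if "s \<ge> t0" for s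
  proof -
    have ac: "abs_cont_on t0 s x" using cls that by (simp add: cls_def)
    have "(h has_integral (x s - x t0)) {t0..s}"
      by (rule abs_cont_on_has_integral_deriv[OF that ac N]) (auto intro: has_vector_derivative_at_within deriv)
    then show ?thesis by (simp add: integral_unique)
  qed
  have "((\<lambda>s. x t0 + integral {t0..s} h) has_vector_derivative 0 + h t) (at t within {t0..})"
    by (intro has_vector_derivative_add has_vector_derivative_const antiderivative_atLeast[OF h \<open>t \<ge> t0\<close>])
  then have "((\<lambda>s. x t0 + integral {t0..s} h) has_vector_derivative h t) (at t within {t0..})"
    by simp
  then have "(x has_vector_derivative h t) (at t within {t0..})"
    by (rule has_vector_derivative_transform[rotated 2]) (simp add: \<open>t \<ge> t0\<close>, rule x_eq, simp)
  then show ?thesis by (simp only: h_def)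
qed

text \<open>Identifies the vector occurring in the matrix inequality with \<open>y'\<close> of
  \<open>krasovskii_segment_has_derivative\<close>.\<close>

lemma bold_F_mult:
  "bold_F r f M *v aug_state r (Fker r f) x w t =
    Fker r f 0 *v x t - Fker r f (-r) *v x (t - r)
    - ((mat_sqrt (matrix_inv (gram r f)) ** M ** mat_sqrt (gram r f)) \<otimes> mat 1)
      *v integral {-r..0} (\<lambda>\<tau>. Fker r f \<tau> *v x (t + \<tau>))"
  by (simp add: bold_F_def aug_state_def)

text \<open>Lets the dissipation inequality for w = 0 act as a Lyapunov inequality.\<close>

lemma supply_rate_zero_nonpos:
  assumes "neg_def (matrix_inv J1)"
  shows "supply_rate Jt J1 J2 J3 z 0 \<le> 0"
proof -
  have "z \<bullet> ((transpose Jt ** matrix_inv J1 ** Jt) *v z) = (Jt *v z) \<bullet> (matrix_inv J1 *v (Jt *v z))"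
    using inner_matrix_transpose[of z "transpose Jt" "matrix_inv J1 *v (Jt *v z)"]
    by (simp add: matrix_vector_mul_assoc[symmetric] del: transpose_matrix_vector)
  also have "\<dots> \<le> 0"
    using assms by (metis neg_def_def inner_zero_left less_eq_real_def)
  finally show ?thesis by (simp add: supply_rate_def del: transpose_matrix_vector)
qed

section \<open>Dissipativity and exponential stability\<close>

context
  fixes r e :: real and f :: "real \<Rightarrow> real^'d" and M :: "real^'d^'d"
    and \<Sigma> :: "real^('n::finite + 'p::finite, 'd::finite, 'q::finite) aug^'m" and Pm :: "real^('n::finite + 'p::finite, 'd::finite, 'q::finite) aug^('n::finite + 'p::finite)"
    and Jt J1 :: "real^'m^'m" and J2 :: "real^'q^'m" and J3 :: "real^'q^'q"
    and P :: "real^('n::finite + 'p::finite)^('n::finite + 'p::finite)" and Q :: "real^('d::finite \<times> ('n::finite + 'p::finite))^('n::finite + 'p::finite)"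
    and R :: "real^('d::finite \<times> ('n::finite + 'p::finite))^('d::finite \<times> ('n::finite + 'p::finite))" and S U :: "real^('n::finite + 'p::finite)^('n::finite + 'p::finite)"
  assumes r_pos: "r > 0"
    and f_ode: "\<And>\<tau>. \<tau> \<in> {-r..0} \<Longrightarrow> (f has_vector_derivative M *v f \<tau>) (at \<tau> within {-r..0})"
    and gram_pos: "pos_def (gram r f)"
    and invJ1: "invertible J1" and negJ1: "neg_def (matrix_inv J1)"
    and sym: "sym_mat P" "sym_mat R"
    and pd: "pos_def ((P ||| Q) /// (transpose Q ||| R + mat 1 \<otimes> S))" and posS: "pos_def S" and posU: "pos_def U"
    and e_pos: "e > 0"
    and lmi: "\<And>a. a \<bullet> ((bold_Phi r (bold_F r f M) \<Sigma> Jt J1 J2 J3 Q R S U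
                + Sy (transpose (bold_P P Q) ** (Pm ||| 0))) *v a) \<le> - e * (norm a)\<^sup>2"
begin

abbreviation (input) "V \<equiv> krasovskii r (Fker r f) P Q R S U"

text \<open>The common source of both conclusions. The difference between the Kronecker form at y
  and the integral of the U-form is left in place: dissipativity discards it, exponential stability
  keeps a fraction.\<close>

lemma storage_derivative:
  assumes x: "continuous_on {t0 - r..} x" and "t \<ge> t0"
    and x': "(x has_vector_derivative Pm *v aug_state r (Fker r f) x w t) (at t within {t0..})"
  defines "y \<equiv> integral {-r..0} (\<lambda>\<tau>. Fker r f \<tau> *v x (t + \<tau>))"
  obtains D where "((\<lambda>t. V (segment_at r x t)) has_real_derivative D) (at t within {t0..})"
    "D \<le> supply_rate Jt J1 J2 J3 (\<Sigma> *v aug_state r (Fker r f) x w t) w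
      - e * ((norm (x t))\<^sup>2 + (norm y)\<^sup>2) + y \<bullet> ((mat 1 \<otimes> U) *v y)
      - integral {-r..0} (\<lambda>\<tau>. x (t + \<tau>) \<bullet> (U *v x (t + \<tau>)))"
proof -
  have "r \<ge> 0" using r_pos by simp
  have Fker': "((Fker r f :: real \<Rightarrow> real^('n + 'p)^('d \<times> ('n + 'p))) has_vector_derivative
      ((mat_sqrt (matrix_inv (gram r f)) ** M ** mat_sqrt (gram r f)) \<otimes> mat 1) ** Fker r f \<tau>)
      (at \<tau> within {-r..0})" if "\<tau> \<in> {-r..0}" for \<tau>
    using f_ode gram_pos that by (rule Fker_has_vector_derivative)
  note D = krasovskii_segment_has_derivative[OF \<open>r \<ge> 0\<close> \<open>t \<ge> t0\<close> sym Fker' x x', of Q S U]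
  note le = lmi_dissipation[OF lmi e_pos invJ1, of "x t" "x (t - r)" "integral {-r..0} (\<lambda>\<tau>. Fker r f \<tau> *v x (t + \<tau>))" w,
      folded aug_state_def, unfolded Let_def bold_F_mult mult_minus_left]
  show ?thesis
    by (rule that[unfolded y_def], rule D, assumption) (use le in linarith)
qed

lemma bessel_U:
  assumes "continuous_on {t0 - r..} x" "t \<ge> t0"
  defines "y \<equiv> integral {-r..0} (\<lambda>\<tau>. Fker r f \<tau> *v x (t + \<tau>))"
  shows "y \<bullet> ((mat 1 \<otimes> U) *v y) \<le> integral {-r..0} (\<lambda>\<tau>. x (t + \<tau>) \<bullet> (U *v x (t + \<tau>)))"
  unfolding y_def
proof (rule Fker_bessel[OF f_ode gram_pos])
  show "continuous_on {-r..0} (\<lambda>\<tau>. x (t + \<tau>))"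
    using assms by (auto intro!: continuous_on_compose2[OF assms(1)] continuous_intros)
  show "sym_mat U" "\<And>v. v \<bullet> (U *v v) \<ge> 0"
    using posU by (metis pos_def_def inner_zero_left less_eq_real_def)+
qed

text \<open>In the bound of \<open>storage_derivative\<close>, the margin term and the difference
  controlled by Bessel's inequality are both nonpositive, leaving the supply rate.\<close>

lemma dissipative_krasovskii:
  assumes sys: "\<And>\<phi> w x z. sys \<phi> w x z \<Longrightarrow> continuous_on {t0 - r..} x \<and>
      (AE t in lebesgue. t \<ge> t0 \<longrightarrow> (x has_vector_derivative Pm *v aug_state r (Fker r f) x (w t) t) (at t)) \<and>
      (AE t in lebesgue. t \<ge> t0 \<longrightarrow> z t = \<Sigma> *v aug_state r (Fker r f) x (w t) t)"
  shows "dissipative r t0 sys (supply_rate Jt J1 J2 J3)"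
proof -
  have "AE t in lebesgue. t \<ge> t0 \<longrightarrow>
      (\<exists>D. ((\<lambda>t. V (segment_at r x t)) has_real_derivative D) (at t) \<and> D - supply_rate Jt J1 J2 J3 (z t) (w t) \<le> 0)"
    if "sys \<phi> w x z" for \<phi> w x z
  proof -
    note S = sys[OF that]
    have "AE t in lebesgue. t \<noteq> t0"
      using AE_completion[OF AE_lborel_singleton[of t0]] .
    with S[THEN conjunct2, THEN conjunct1] S[THEN conjunct2, THEN conjunct2] show ?thesis
    proof eventually_elim
      case (elim t)
      show ?case
      proof
        assume "t \<ge> t0"
        with elim have t: "t > t0"
          and x': "(x has_vector_derivative Pm *v aug_state r (Fker r f) x (w t) t) (at t)"
          and z: "z t = \<Sigma> *v aug_state r (Fker r f) x (w t) t"
          by auto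
        obtain D where D: "((\<lambda>t. V (segment_at r x t)) has_real_derivative D) (at t within {t0..})"
          "D \<le> supply_rate Jt J1 J2 J3 (z t) (w t)
            - e * ((norm (x t))\<^sup>2 + (norm (integral {-r..0} (\<lambda>\<tau>. Fker r f \<tau> *v x (t + \<tau>))))\<^sup>2)
            + integral {-r..0} (\<lambda>\<tau>. Fker r f \<tau> *v x (t + \<tau>)) \<bullet> ((mat 1 \<otimes> U) *v integral {-r..0} (\<lambda>\<tau>. Fker r f \<tau> *v x (t + \<tau>)))
            - integral {-r..0} (\<lambda>\<tau>. x (t + \<tau>) \<bullet> (U *v x (t + \<tau>)))"
          using storage_derivative[OF S[THEN conjunct1] \<open>t \<ge> t0\<close> has_vector_derivative_at_within[OF x']]
          unfolding z by blast
        have "at t within {t0..} = at t"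
          using t by (intro at_within_interior) simp
        moreover have "0 \<le> e * ((norm (x t))\<^sup>2 + (norm (integral {-r..0} (\<lambda>\<tau>. Fker r f \<tau> *v x (t + \<tau>))))\<^sup>2)"
          using e_pos by simp
        ultimately show "\<exists>D. ((\<lambda>t. V (segment_at r x t)) has_real_derivative D) (at t) \<and>
            D - supply_rate Jt J1 J2 J3 (z t) (w t) \<le> 0"
          using D bessel_U[OF S[THEN conjunct1] \<open>t \<ge> t0\<close>] by (intro exI[of _ D] conjI) (simp, linarith)
      qed
    qed
  qed
  then show ?thesis
    unfolding dissipative_def
    using continuous_map_krasovskii[OF _ continuous_on_Fker[OF f_ode gram_pos], of P Q R S U] r_pos
    by (intro exI[of _ V] conjI allI impI) auto
qed

text \<open>W bounds the squared norm of the state from below, and is itself bounded above by that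
  square plus the integral I of the history. Decay therefore needs a negative multiple of I in the
  derivative, which can come only from the U-integral.\<close>

lemma zero_exp_stable_krasovskii:
  assumes sys: "\<And>\<phi> x z. sys \<phi> (\<lambda>_. 0 :: real^'q) x z \<Longrightarrow> continuous_on {-r..0} \<phi> \<and> (\<forall>\<theta>\<in>{-r..0}. x (t0 + \<theta>) = \<phi> \<theta>) \<and>
      continuous_on {t0 - r..} x \<and>
      (\<forall>t\<ge>t0. (x has_vector_derivative Pm *v aug_state r (Fker r f) x 0 t) (at t within {t0..}))"
  shows "zero_exp_stable r t0 sys"
proof -
  obtain c1 where "c1 > 0" and c1: "\<And>\<phi>. continuous_on {-r..0} \<phi> \<Longrightarrow> c1 * (norm (\<phi> 0))\<^sup>2 \<le> V \<phi>"
    using krasovskii_lower_bound[OF r_pos f_ode gram_pos pd posS posU] by blast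
  obtain c2 where "c2 > 0" and c2: "\<And>\<phi>. continuous_on {-r..0} \<phi> \<Longrightarrow>
      V \<phi> \<le> c2 * ((norm (\<phi> 0))\<^sup>2 + integral {-r..0} (\<lambda>\<tau>. (norm (\<phi> \<tau>))\<^sup>2))"
    using krasovskii_upper_bound[OF r_pos f_ode gram_pos posU] by blast
  obtain b where "b > 0" and b: "\<And>y :: real^('d \<times> ('n + 'p)). y \<bullet> ((mat 1 \<otimes> U) *v y) \<le> b * (norm y)\<^sup>2"
    using quadratic_form_bound by blast
  obtain cU where "cU > 0" and cU: "\<And>v. v \<bullet> (U *v v) \<ge> cU * (norm v)\<^sup>2"
    using pos_defD_coercive[OF posU] by blast
  \<comment> \<open>The fraction of the U-integral that is kept. \<open>\<eta> \<le> 1\<close>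
    permits passing to the fraction of a nonpositive difference; \<open>\<eta> * b \<le> e\<close>
    lets the margin in y absorb the Kronecker form.\<close>
  define \<eta> where "\<eta> = min 1 (e / b)"
  have \<eta>: "0 < \<eta>" "\<eta> \<le> 1" "\<eta> * b \<le> e"
    using e_pos \<open>b > 0\<close> by (auto simp: \<eta>_def min_def field_simps)
  \<comment> \<open>A common coefficient for the squared norm of the state and for I.\<close>
  define m where "m = min e (\<eta> * cU)"
  have m: "0 < m" "m \<le> e" "m \<le> \<eta> * cU"
    using e_pos \<eta>(1) \<open>cU > 0\<close> by (auto simp: m_def)
  \<comment> \<open>Chosen so that \<alpha> times the upper bound on W is exactly what the
    derivative loses.\<close>
  define \<alpha> where "\<alpha> = m / c2"
  have "\<alpha> > 0" using m \<open>c2 > 0\<close> by (simp add: \<alpha>_def)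
  \<comment> \<open>At t0 the upper bound is at most c2 (1 + r) times the squared sup norm of
    \<phi>, and c1 comes from the lower bound at t.\<close>
  define \<beta> where "\<beta> = sqrt (c2 * (1 + r) / c1)"
  have "\<beta> > 0" using \<open>c1 > 0\<close> \<open>c2 > 0\<close> r_pos by (simp add: \<beta>_def)
  \<comment> \<open>The rate is halved because W is comparable to squares of norms.\<close>
  have "norm (x t) \<le> \<beta> * exp (- (\<alpha> / 2) * (t - t0)) * (SUP \<theta>\<in>{-r..0}. norm (\<phi> \<theta>))"
    if cls: "sys \<phi> (\<lambda>_. 0) x z" and "t \<ge> t0" for \<phi> x z t
  proof -
    have \<phi>: "continuous_on {-r..0} \<phi>" and init: "\<forall>\<theta>\<in>{-r..0}. x (t0 + \<theta>) = \<phi> \<theta>"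
      and x: "continuous_on {t0 - r..} x"
      and x': "\<And>t. t \<ge> t0 \<Longrightarrow> (x has_vector_derivative Pm *v aug_state r (Fker r f) x 0 t) (at t within {t0..})"
      using sys[OF cls] by auto
    define I where "I s = integral {-r..0} (\<lambda>\<tau>. (norm (x (s + \<tau>)))\<^sup>2)" for s
    define W where "W s = V (segment_at r x s)" for s
    have shift: "continuous_on {-r..0} (\<lambda>\<tau>. x (s + \<tau>))" if "s \<ge> t0" for s
      using that by (auto intro!: continuous_on_compose2[OF x] continuous_intros)
    have W_eq: "W s = V (\<lambda>\<tau>. x (s + \<tau>))" for s
      unfolding W_def using r_pos by (intro krasovskii_cong) (auto simp: segment_at_def)
    have lower: "c1 * (norm (x s))\<^sup>2 \<le> W s" if "s \<ge> t0" for s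
      using c1[OF shift[OF that]] by (simp add: W_eq)
    have upper: "W s \<le> c2 * ((norm (x s))\<^sup>2 + I s)" if "s \<ge> t0" for s
      using c2[OF shift[OF that]] by (simp add: W_eq I_def)
    have decay: "\<exists>D. (W has_real_derivative D) (at s within {t0..}) \<and> D + \<alpha> * W s \<le> 0" if s: "s \<ge> t0" for s
    proof -
      define y where "y = integral {-r..0} (\<lambda>\<tau>. Fker r f \<tau> *v x (s + \<tau>))"
      let ?u = "y \<bullet> ((mat 1 \<otimes> U) *v y)" and ?U = "integral {-r..0} (\<lambda>\<tau>. x (s + \<tau>) \<bullet> (U *v x (s + \<tau>)))"
      obtain D where D: "(W has_real_derivative D) (at s within {t0..})"
        "D \<le> supply_rate Jt J1 J2 J3 (\<Sigma> *v aug_state r (Fker r f) x 0 s) 0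
            - e * ((norm (x s))\<^sup>2 + (norm y)\<^sup>2) + ?u - ?U"
        using storage_derivative[OF x s x'[OF s]] unfolding W_def[symmetric] y_def[symmetric] by blast
      have "?u - ?U \<le> 0"
        using bessel_U[OF x s] by (simp add: y_def)
      then have "1 * (?u - ?U) \<le> \<eta> * (?u - ?U)"
        using \<eta> by (intro mult_right_mono_neg) auto
      also have "\<eta> * (?u - ?U) \<le> e * (norm y)\<^sup>2 - (\<eta> * cU) * I s"
      proof -
        have "\<eta> * ?u \<le> \<eta> * (b * (norm y)\<^sup>2)"
          using \<eta>(1) b[of y] by (intro mult_left_mono) auto
        also have "\<dots> \<le> e * (norm y)\<^sup>2"
          unfolding mult.assoc[symmetric] using \<eta>(3) by (intro mult_right_mono) auto
        finally have "\<eta> * ?u \<le> e * (norm y)\<^sup>2" .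
        moreover have "cU * I s \<le> ?U"
          unfolding I_def integral_mult_right[symmetric]
        proof (rule integral_le)
          show "(\<lambda>\<tau>. cU * (norm (x (s + \<tau>)))\<^sup>2) integrable_on {-r..0}"
            "(\<lambda>\<tau>. x (s + \<tau>) \<bullet> (U *v x (s + \<tau>))) integrable_on {-r..0}"
            by (intro integrable_continuous_interval continuous_on_form shift s continuous_intros)+
        qed (rule cU)
        then have "\<eta> * (cU * I s) \<le> \<eta> * ?U" using \<eta>(1) by simp
        ultimately show ?thesis by (simp add: right_diff_distrib mult.assoc)
      qed
      finally have "D \<le> - (e * (norm (x s))\<^sup>2 + (\<eta> * cU) * I s)"
        using D(2) supply_rate_zero_nonpos[OF negJ1, of Jt J2 J3 "\<Sigma> *v aug_state r (Fker r f) x 0 s"]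
        by (simp add: distrib_left)
      moreover have "m * (norm (x s))\<^sup>2 \<le> e * (norm (x s))\<^sup>2"
        using m by (intro mult_right_mono) auto
      moreover have "m * I s \<le> (\<eta> * cU) * I s"
        using m by (intro mult_right_mono) (auto simp: I_def intro!: integral_nonneg integrable_continuous_interval continuous_intros shift s)
      moreover have "\<alpha> * W s \<le> \<alpha> * (c2 * ((norm (x s))\<^sup>2 + I s))"
        using upper[OF s] \<open>\<alpha> > 0\<close> by simp
      moreover have "\<alpha> * (c2 * ((norm (x s))\<^sup>2 + I s)) = m * (norm (x s))\<^sup>2 + m * I s"
        using \<open>c2 > 0\<close> by (simp add: \<alpha>_def distrib_left)
      ultimately have "D + \<alpha> * W s \<le> 0" by linarith
      with D(1) show ?thesis by blast
    qed
    have deriv: "\<exists>D. ((\<lambda>s. exp (\<alpha> * (s - t0)) * W s) has_real_derivative D) (at s within {t0..}) \<and> D \<le> 0" if s: "s \<ge> t0" for s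
    proof -
      obtain D where D: "(W has_real_derivative D) (at s within {t0..})" "D + \<alpha> * W s \<le> 0"
        using decay[OF s] by blast
      have "((\<lambda>s. exp (\<alpha> * (s - t0)) * W s) has_real_derivative exp (\<alpha> * (s - t0)) * (D + \<alpha> * W s)) (at s within {t0..})"
        by (rule derivative_eq_intros D(1) refl)+ (simp add: algebra_simps)
      moreover have "exp (\<alpha> * (s - t0)) * (D + \<alpha> * W s) \<le> 0"
        using D(2) by (simp add: mult_nonneg_nonpos)
      ultimately show ?thesis by blast
    qed
    \<comment> \<open>Two-sided derivatives are needed only in the open interval; the one-sided
      derivative at t0 supplies continuity at the left end.\<close>
    have "exp (\<alpha> * (t - t0)) * W t \<le> exp (\<alpha> * (t0 - t0)) * W t0"
    proof (rule DERIV_nonpos_imp_decreasing_open[OF \<open>t \<ge> t0\<close>, where f = "\<lambda>s. exp (\<alpha> * (s - t0)) * W s"])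
      fix s assume "t0 < s" "s < t"
      then have "at s within {t0..} = at s"
        by (intro at_within_interior) simp
      then show "\<exists>D. ((\<lambda>s. exp (\<alpha> * (s - t0)) * W s) has_real_derivative D) (at s) \<and> D \<le> 0"
        using deriv[of s] \<open>t0 < s\<close> by auto
    next
      have "continuous_on {t0..} (\<lambda>s. exp (\<alpha> * (s - t0)) * W s)"
        unfolding continuous_on_eq_continuous_within
        using deriv by (meson DERIV_continuous atLeast_iff)
      then show "continuous_on {t0..t} (\<lambda>s. exp (\<alpha> * (s - t0)) * W s)"
        by (rule continuous_on_subset) auto
    qed
    then have "exp (- \<alpha> * (t - t0)) * (exp (\<alpha> * (t - t0)) * W t) \<le> exp (- \<alpha> * (t - t0)) * W t0"
      by simp
    then have W_decay: "W t \<le> exp (- \<alpha> * (t - t0)) * W t0"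
      by (simp add: mult.assoc[symmetric] exp_add[symmetric])
    define B where "B = (SUP \<theta>\<in>{-r..0}. norm (\<phi> \<theta>))"
    have bdd: "bdd_above ((\<lambda>\<theta>. norm (\<phi> \<theta>)) ` {-r..0})"
      by (intro bounded_imp_bdd_above compact_imp_bounded compact_continuous_image continuous_intros \<phi> compact_Icc)
    have B: "norm (x (t0 + \<theta>)) \<le> B" if "\<theta> \<in> {-r..0}" for \<theta>
      unfolding B_def using init that by (auto intro: cSUP_upper[OF _ bdd])
    have "B \<ge> 0"
      using r_pos by (intro order_trans[OF norm_ge_zero B[of 0]]) simp
    have "I t0 \<le> integral {-r..0} (\<lambda>_. B\<^sup>2)"
      unfolding I_def
    proof (rule integral_le)
      show "(\<lambda>\<tau>. (norm (x (t0 + \<tau>)))\<^sup>2) integrable_on {-r..0}" "(\<lambda>_. B\<^sup>2) integrable_on {-r..0}"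
        by (intro integrable_continuous_interval continuous_intros shift order_refl)+
    qed (use B in \<open>auto intro: power_mono\<close>)
    also have "\<dots> = r * B\<^sup>2" using r_pos by simp
    finally have "c2 * ((norm (x t0))\<^sup>2 + I t0) \<le> c2 * (B\<^sup>2 + r * B\<^sup>2)"
      using B[of 0] r_pos \<open>c2 > 0\<close> by (intro mult_left_mono add_mono power_mono) auto
    then have "W t0 \<le> c2 * (1 + r) * B\<^sup>2"
      using upper[of t0] by (simp add: algebra_simps)
    then have "exp (- \<alpha> * (t - t0)) * W t0 \<le> exp (- \<alpha> * (t - t0)) * (c2 * (1 + r) * B\<^sup>2)"
      by (intro mult_left_mono) auto
    with lower[OF \<open>t \<ge> t0\<close>] W_decay have "c1 * (norm (x t))\<^sup>2 \<le> exp (- \<alpha> * (t - t0)) * (c2 * (1 + r) * B\<^sup>2)"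
      by linarith
    then have "(norm (x t))\<^sup>2 \<le> (c2 * (1 + r) / c1) * exp (- \<alpha> * (t - t0)) * B\<^sup>2"
      using \<open>c1 > 0\<close> by (simp add: field_simps)
    also have "\<dots> = (\<beta> * exp (- (\<alpha> / 2) * (t - t0)) * B)\<^sup>2"
    proof -
      have "\<beta>\<^sup>2 = c2 * (1 + r) / c1"
        using \<open>c1 > 0\<close> \<open>c2 > 0\<close> r_pos by (simp add: \<beta>_def)
      moreover have "(exp (- (\<alpha> / 2) * (t - t0)))\<^sup>2 = exp (- \<alpha> * (t - t0))"
        by (simp add: power2_eq_square exp_add[symmetric])
      ultimately show ?thesis by (simp add: power_mult_distrib)
    qed
    finally show ?thesis
      unfolding B_def[symmetric] using \<open>\<beta> > 0\<close> \<open>B \<ge> 0\<close> by (auto intro: power2_le_imp_le)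
  qed
  then show ?thesis
    unfolding zero_exp_stable_def using \<open>\<alpha> > 0\<close> \<open>\<beta> > 0\<close>
    by (intro exI[of _ "\<alpha> / 2"] exI[of _ \<beta>] conjI allI impI) auto
qed

end

theorem theorem1:
  fixes r t0 :: real
    and A :: "real^'n^'n" and B :: "real^'p^'n"
    and D1 :: "real^'q^'n" and D2 :: "real^'q^'p" and D3 :: "real^'q^'m"
    and C1 C2 :: "real^('n + 'p)^'m" and C3t :: "real \<Rightarrow> real^('n + 'p)^'m"
    and Jt J1 :: "real^'m^'m" and J2 :: "real^'q^'m" and J3 :: "real^'q^'q"
    and f :: "real \<Rightarrow> real^'d" and M :: "real^'d^'d"
    and C3 :: "real^('d \<times> ('n + 'p))^'m" and \<Gamma> :: "real^('d \<times> ('n + 'p))^'p"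
    and K :: "real^'n^'p" and X :: "real^'p^'p"
    and P :: "real^('n + 'p)^('n + 'p)" and Q :: "real^('d \<times> ('n + 'p))^('n + 'p)"
    and R :: "real^('d \<times> ('n + 'p))^('d \<times> ('n + 'p))" and S U :: "real^('n + 'p)^('n + 'p)"
    and K1 K2 :: "real^('n + 'p)^'p" and K3 :: "real^('d \<times> ('n + 'p))^'p"
  assumes "r > 0"
    and "hurwitz (A + B ** K)" and "hurwitz X"
    and "sym_mat J1" and "invertible J1" and "neg_def (matrix_inv J1)" and "sym_mat J3"
    and "\<And>\<tau>. \<tau> \<in> {-r..0} \<Longrightarrow> (f has_vector_derivative M *v f \<tau>) (at \<tau> within {-r..0})"
    and "pos_def (gram r f)"
    and "\<And>\<tau>. \<tau> \<in> {-r..0} \<Longrightarrow> C3t \<tau> = C3 ** Fker r f \<tau>"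
    and "\<And>\<tau>. \<tau> \<in> {-r..0} \<Longrightarrow>
           (0 ||| (K ** A - X ** K) ** mat_exp (- (\<tau> *\<^sub>R A)) ** B) = \<Gamma> ** Fker r f \<tau>"
    and "(P, Q, R, S, U, K1, K2, K3) \<in> unknowns_space"
    and "pos_def ((P ||| Q) /// (transpose Q ||| R + mat 1 \<otimes> S))" and "pos_def S" and "pos_def U"
    and "neg_def (bold_Phi r (bold_F r f M) (bold_Sigma C1 C2 C3 D3) Jt J1 J2 J3 Q R S U
                  + Sy (transpose (bold_P P Q) ** (bold_Pi A B D1 D2 K1 K2 K3 ||| 0)))"
  shows "dissipative r t0 (cls r t0 A B D1 D2 D3 C1 C2 C3 (Fker r f) K1 K2 K3)
           (supply_rate Jt J1 J2 J3) \<and>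
         zero_exp_stable r t0 (cls r t0 A B D1 D2 D3 C1 C2 C3 (Fker r f) K1 K2 K3) \<and>
         (let d = real CARD('d); p = real CARD('p); \<nu> = real CARD('n + 'p) in
           real (dim (unknowns_space :: ('n + 'p, 'p, 'd) unknowns set))
             = (0.5 * d\<^sup>2 + d + 1.5) * \<nu>\<^sup>2 + (0.5 * d + p * d + 2 * p + 1.5) * \<nu>) \<and>
         (\<lambda>(d, n, p). let \<nu> = real n + real p in
            (0.5 * (real d)\<^sup>2 + real d + 1.5) * \<nu>\<^sup>2
            + (0.5 * real d + real p * real d + 2 * real p + 1.5) * \<nu>)
         \<in> O[principal {(d::nat, n::nat, p::nat). d \<ge> 1 \<and> n \<ge> 1 \<and> p \<ge> 1}](
             \<lambda>(d, n, p). (real d)\<^sup>2 * (real n + real p)\<^sup>2)"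
proof (intro conjI)
  let ?sys = "cls r t0 A B D1 D2 D3 C1 C2 C3 (Fker r f) K1 K2 K3"
  let ?\<Pi> = "bold_Pi A B D1 D2 K1 K2 K3" and ?\<Sigma> = "bold_Sigma C1 C2 C3 D3"
  note r_pos = assms(1) and J1 = assms(5,6) and f_ode = assms(8) and gram_pos = assms(9)
  \<comment> \<open>Compactness of the unit sphere upgrades strict negativity to the uniform margin
    e.\<close>
  obtain e where "e > 0" and lmi: "\<And>a. a \<bullet> ((bold_Phi r (bold_F r f M) ?\<Sigma> Jt J1 J2 J3 Q R S U
      + Sy (transpose (bold_P P Q) ** (?\<Pi> ||| 0))) *v a) \<le> - e * (norm a)\<^sup>2"
    using neg_defD_coercive[OF assms(16)] by blast
  have sym: "sym_mat P" "sym_mat R"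
    using assms(12) by (simp_all add: unknowns_space_def)
  have "r \<ge> 0" using r_pos by simp
  have Fker': "((Fker r f :: real \<Rightarrow> real^('n + 'p)^('d \<times> ('n + 'p))) has_vector_derivative
      ((mat_sqrt (matrix_inv (gram r f)) ** M ** mat_sqrt (gram r f)) \<otimes> mat 1) ** Fker r f \<tau>)
      (at \<tau> within {-r..0})" if "\<tau> \<in> {-r..0}" for \<tau>
    using f_ode gram_pos that by (rule Fker_has_vector_derivative)
  have contF: "continuous_on {-r..0} (Fker r f :: real \<Rightarrow> real^('n + 'p)^('d \<times> ('n + 'p)))"
    using Fker' by (rule continuous_on_vector_derivative)
  show "dissipative r t0 ?sys (supply_rate Jt J1 J2 J3)"
  proof (rule dissipative_krasovskii[OF r_pos f_ode gram_pos J1 sym assms(13-15) \<open>e > 0\<close> lmi], assumption)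
    fix \<phi> w x z assume cls: "?sys \<phi> w x z"
    show "continuous_on {t0 - r..} x \<and>
      (AE t in lebesgue. t \<ge> t0 \<longrightarrow> (x has_vector_derivative ?\<Pi> *v aug_state r (Fker r f) x (w t) t) (at t)) \<and>
      (AE t in lebesgue. t \<ge> t0 \<longrightarrow> z t = ?\<Sigma> *v aug_state r (Fker r f) x (w t) t)"
      by (intro conjI cls_continuous_on[OF cls \<open>r \<ge> 0\<close>] cls_augmented[OF cls \<open>r \<ge> 0\<close> contF])
  qed
  show "zero_exp_stable r t0 ?sys"
  proof (rule zero_exp_stable_krasovskii[OF r_pos f_ode gram_pos J1 sym assms(13-15) \<open>e > 0\<close> lmi], assumption)
    fix \<phi> x z assume cls: "?sys \<phi> (\<lambda>_. 0) x z"
    then have "continuous_on {-r..0} \<phi>" "\<forall>\<theta>\<in>{-r..0}. x (t0 + \<theta>) = \<phi> \<theta>"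
      by (simp_all add: cls_def)
    moreover have "continuous_on {t0 - r..} x"
      by (rule cls_continuous_on[OF cls \<open>r \<ge> 0\<close>])
    moreover have "(x has_vector_derivative ?\<Pi> *v aug_state r (Fker r f) x 0 t) (at t within {t0..})" if "t \<ge> t0" for t
      by (rule cls_undisturbed_has_derivative[OF cls \<open>r \<ge> 0\<close> Fker' that])
    ultimately show "continuous_on {-r..0} \<phi> \<and> (\<forall>\<theta>\<in>{-r..0}. x (t0 + \<theta>) = \<phi> \<theta>) \<and>
        continuous_on {t0 - r..} x \<and>
        (\<forall>t\<ge>t0. (x has_vector_derivative ?\<Pi> *v aug_state r (Fker r f) x 0 t) (at t within {t0..}))"
      by blast
  qed
  show "let d = real CARD('d); p = real CARD('p); \<nu> = real CARD('n + 'p) in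
      real (dim (unknowns_space :: ('n + 'p, 'p, 'd) unknowns set))
        = (0.5 * d\<^sup>2 + d + 1.5) * \<nu>\<^sup>2 + (0.5 * d + p * d + 2 * p + 1.5) * \<nu>"
    unfolding Let_def by (rule dim_unknowns_space)
qed (rule unknowns_count_bigo)

end
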